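(* Let $\mathbf{w}\in\mathcal{V}$. Every vertex of the secondary polytope of $\mathcal{O}(Q_{\mathbf{w}})$ corresponds to a unimodular (regular) triangulation of $\mathcal{O}(Q_{\mathbf{w}})$. Thus, every triangulation of $\mathcal{O}(Q_{\mathbf{w}})$ is unimodular.
   Context: A generalized snake word of length $n\ge 0$ is a word $\mathbf{w}=w_0w_1\cdots w_n$ where $w_0=\varepsilon$ is the empty letter and $w_i\in\{L,R\}$ for $1\le i\le n$. $\mathcal{V}$ is the set of generalized snake words that do not contain $LRL$ or $RLR$ as a (contiguous) substring. The generalized snake poset $P(\mathbf{w})$ is defined recursively ($\prec$ denotes a cover relation). $P(\varepsilon)$ is the poset on $\{0,1,2,3\}$ with cover relations $1\prec 0$, $2\prec 0$, $3\prec 1$, $3\prec 2$. For $n\ge 1$, $P(w_0\cdots w_n)$ is $P(w_0\cdots w_{n-1})\cup\{2n+2,2n+3\}$ with the added cover relations $2n+3\prec 2n+1$, $2n+3\prec 2n+2$, and: $2n+2\prec 2n-1$ if ($n=1$ and $w_n=L$) or ($n\ge2$ and $w_{n-1}w_n\in\{RL,LR\}$); $2n+2\prec 2n$ if ($n=1$ and $w_n=R$) or ($n\ge 2$ and $w_{n-1}w_n\in\{LL,RR\}$). Let $\widehat{P}(\mathbf{w})$ be $P(\mathbf{w})$ with a new minimum $\widehat 0$ and a new maximum $\widehat 1$ adjoined; it is a distributive lattice. $Q_{\mathbf{w}}$ is the poset of meet-irreducible elements of $\widehat P(\mathbf{w})$ (elements $\ne\widehat 1$ covered by exactly one element), with the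 induced order. For a finite poset $Q$, the order polytope is $\mathcal{O}(Q)=\{x\in[0,1]^Q: x_i\le x_j \text{ whenever } i<_Q j\}$; its vertices are the indicator vectors of the filters (upper order ideals) of $Q$. A triangulation of $\mathcal{O}(Q)$ means a triangulation of the point configuration of its vertices: a collection of full-dimensional simplices with vertices among the vertices of $\mathcal{O}(Q)$, whose union is $\mathcal{O}(Q)$ and any two of which meet in a (possibly empty) common face. It is unimodular if every simplex in it has normalized volume $1$ (normalized volume in dimension $d$ is $d!$ times Euclidean volume). It is regular if it is the projection of the lower envelope of a lifting of the vertices by some height function. The secondary polytope is the convex hull of the GKZ-vectors of all triangulations of the vertex configuration; its vertices are exactly the GKZ-vectors of the regular triangulations (the GKZ-vector of $\mathcal{T}$ has, for each vertex $v$, coordinate equal to the sum of the volumes of the simplices of $\mathcal{T}$ containing $v$). *)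

theory Defs
  imports "HOL-Analysis.Analysis" "HOL-Library.Sublist"
begin

subsection \<open>Generalized snake words and posets\<close>

datatype letter = L | R

(* A word w_0 w_1 ... w_n is the list [w_1, ..., w_n]; the empty letter w_0 is not stored. *)
definition snake_letter :: "letter list \<Rightarrow> nat \<Rightarrow> letter" where
  "snake_letter w i = w ! (i - 1)"

definition words_V :: "letter list set" where
  "words_V = {w. \<not> sublist [L, R, L] w \<and> \<not> sublist [R, L, R] w}"

(* snake_covers w n: the cover relations of P(w_0 ... w_n); (x, y) means that y covers x. *)
primrec snake_covers :: "letter list \<Rightarrow> nat \<Rightarrow> (nat \<times> nat) set" where
  "snake_covers w 0 = {(1, 0), (2, 0), (3, 1), (3, 2)}"
| "snake_covers w (Suc m) =
    (let n = Suc m in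
      snake_covers w m \<union> {(2*n+3, 2*n+1), (2*n+3, 2*n+2)} \<union>
      (if n = 1 \<and> snake_letter w n = L \<or>
          n \<ge> 2 \<and> (snake_letter w (n-1), snake_letter w n) \<in> {(R, L), (L, R)}
       then {(2*n+2, 2*n-1)} else {}) \<union>
      (if n = 1 \<and> snake_letter w n = R \<or>
          n \<ge> 2 \<and> (snake_letter w (n-1), snake_letter w n) \<in> {(L, L), (R, R)}
       then {(2*n+2, 2*n)} else {}))"

definition snake_carrier :: "letter list \<Rightarrow> nat set" where
  "snake_carrier w = {0..2 * length w + 3}"

definition snake_less :: "letter list \<Rightarrow> (nat \<times> nat) set" where
  "snake_less w = (snake_covers w (length w))\<^sup>+"

datatype 'a hat = Bot | Elt 'a | Top

definition hat_carrier :: "'a set \<Rightarrow> 'a hat set" where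
  "hat_carrier A = {Bot, Top} \<union> Elt ` A"

definition hat_less :: "'a set \<Rightarrow> ('a \<times> 'a) set \<Rightarrow> ('a hat \<times> 'a hat) set" where
  "hat_less A r = {(Bot, Top)} \<union> {(Bot, Elt a) | a. a \<in> A} \<union> {(Elt a, Top) | a. a \<in> A}
     \<union> {(Elt a, Elt b) | a b. (a, b) \<in> r}"

definition snake_hat :: "letter list \<Rightarrow> nat hat set" where
  "snake_hat w = hat_carrier (snake_carrier w)"

definition snake_hat_less :: "letter list \<Rightarrow> (nat hat \<times> nat hat) set" where
  "snake_hat_less w = hat_less (snake_carrier w) (snake_less w)"

definition covered_by :: "('a \<times> 'a) set \<Rightarrow> 'a \<Rightarrow> 'a \<Rightarrow> bool" where
  "covered_by r x y \<longleftrightarrow> (x, y) \<in> r \<and> \<not> (\<exists>z. (x, z) \<in> r \<and> (z, y) \<in> r)"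

(* The carrier of Q_w; its order is the restriction of snake_hat_less w. *)
definition snake_Q :: "letter list \<Rightarrow> nat hat set" where
  "snake_Q w = {x \<in> snake_hat w. x \<noteq> Top \<and> (\<exists>!y. covered_by (snake_hat_less w) x y)}"

subsection \<open>Order polytopes and their triangulations\<close>

(* The poset is carried by a finite type, lt being its strict order. *)
definition order_polytope :: "('n::finite \<Rightarrow> 'n \<Rightarrow> bool) \<Rightarrow> (real ^ 'n) set" where
  "order_polytope lt =
     {x. (\<forall>i. 0 \<le> x $ i \<and> x $ i \<le> 1) \<and> (\<forall>i j. lt i j \<longrightarrow> x $ i \<le> x $ j)}"

definition polytope_vertices :: "'a::real_vector set \<Rightarrow> 'a set" where
  "polytope_vertices P = {v. v extreme_point_of P}"

(* The constant triangulation requires finitely many simplices, any two of which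
   meet in a common face. *)
definition is_triangulation_of :: "'a::euclidean_space set set \<Rightarrow> 'a set \<Rightarrow> bool" where
  "is_triangulation_of T P \<longleftrightarrow>
     triangulation T \<and>
     (\<forall>S\<in>T. int DIM('a) simplex S \<and> polytope_vertices S \<subseteq> polytope_vertices P) \<and>
     \<Union>T = P"

definition normalized_volume :: "'a::euclidean_space set \<Rightarrow> real" where
  "normalized_volume S = fact DIM('a) * measure lborel S"

definition unimodular :: "'a::euclidean_space set set \<Rightarrow> bool" where
  "unimodular T \<longleftrightarrow> (\<forall>S\<in>T. normalized_volume S = 1)"

definition lifted_polytope :: "'a::euclidean_space set \<Rightarrow> ('a \<Rightarrow> real) \<Rightarrow> ('a \<times> real) set" where
  "lifted_polytope P h = convex hull ((\<lambda>v. (v, h v)) ` polytope_vertices P)"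

(* A lower face is the set where a linear functional with last coordinate 1 attains its
   minimum b on the lifted polytope. *)
definition lower_face_of :: "('a \<times> real) set \<Rightarrow> ('a::euclidean_space \<times> real) set \<Rightarrow> bool" where
  "lower_face_of F K \<longleftrightarrow>
     (\<exists>c b. (\<forall>(x, t)\<in>K. b \<le> c \<bullet> x + t) \<and> F = {(x, t). (x, t) \<in> K \<and> c \<bullet> x + t = b})"

(* The maximal cells of the lower envelope are exactly its DIM('a)-dimensional faces when P is
   full-dimensional; this includes the case of an affine h, where the whole lifted polytope is
   its own lower face. *)
definition lower_envelope_projection ::
    "'a::euclidean_space set \<Rightarrow> ('a \<Rightarrow> real) \<Rightarrow> 'a set set" where
  "lower_envelope_projection P h =
     {fst ` F | F. lower_face_of F (lifted_polytope P h) \<and> aff_dim F = int DIM('a)}"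

definition is_regular_triangulation_of :: "'a::euclidean_space set set \<Rightarrow> 'a set \<Rightarrow> bool" where
  "is_regular_triangulation_of T P \<longleftrightarrow>
     is_triangulation_of T P \<and> (\<exists>h. T = lower_envelope_projection P h)"

definition indicator_vec :: "'n::finite set \<Rightarrow> real ^ 'n" where
  "indicator_vec F = (\<chi> i. if i \<in> F then 1 else 0)"

(* The vertices of an order polytope are the indicator vectors of the filters of the poset, so
   the coordinate of the vertex indicator_vec F is indexed by the set F.  When F is not a filter,
   indicator_vec F lies outside the polytope and the coordinate is identically 0. *)
definition gkz_vector :: "(real ^ 'n::finite) set set \<Rightarrow> real ^ ('n set)" where
  "gkz_vector T = (\<chi> F. \<Sum>S | S \<in> T \<and> indicator_vec F \<in> S. measure lborel S)"

definition secondary_polytope :: "(real ^ 'n::finite) set \<Rightarrow> (real ^ ('n set)) set" where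
  "secondary_polytope P = convex hull {gkz_vector T | T. is_triangulation_of T P}"

(* The order polytope of Q_w.  The type 'n labels the coordinates: e is a bijection onto Q_w. *)
definition snake_order_polytope :: "letter list \<Rightarrow> ('n::finite \<Rightarrow> nat hat) \<Rightarrow> (real ^ 'n) set" where
  "snake_order_polytope w e = order_polytope (\<lambda>i j. (e i, e j) \<in> snake_hat_less w)"

end

theory Submission
  imports Defs
begin

text \<open>Unimodularity: list the elements of Q_w from top to bottom. Every nonempty filter is an
  initial segment of this list, possibly with one element removed. For an affine function with
  values s_k on the initial segments there are signs and a potential p on the indices such that
  the value on every filter is, up to a sign independent of p, a difference p_i - p_j; so the
  configuration of vertices is graphic. Replacing p by the indicator function of one of its level
  sets turns an affine function with value 1 at a vertex v into an integral one that has value 1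
  at v and still vanishes wherever the original did. Hence the barycentric coordinates of every
  full-dimensional simplex are integral affine functions, which forces its normalized volume to
  be 1.

  Regularity: a vertex z of the secondary polytope is the unique minimizer, among the GKZ vectors,
  of some linear functional H, and H can be perturbed to a generic one. Used as heights, a generic
  H induces a regular triangulation. Since the integral of an affine function over a simplex is
  the volume times the average over the vertices, H applied to the GKZ vector of a triangulation is
  a multiple of the integral of the piecewise linear interpolation of the heights. The lower
  envelope is below all of these interpolations, so its GKZ vector is z.\<close>

subsection \<open>Volumes and integrals over simplices\<close>

text \<open>HOL-Analysis proves the change of variables formula only for well-ordered coordinate index
  types; the type wo is a well-ordered copy of an arbitrary finite index type.\<close>

typedef (overloaded) 'a wo = "UNIV :: 'a set" by auto

instance wo :: (finite) finite
proof
  have "(UNIV :: 'a wo set) = Abs_wo ` (UNIV :: 'a set)"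
    by (metis Abs_wo_cases UNIV_eq_I image_eqI)
  then show "finite (UNIV :: 'a wo set)" by (metis finite finite_imageI)
qed

instantiation wo :: (finite) wellorder
begin
definition "x \<le> y \<longleftrightarrow> to_nat (Rep_wo x) \<le> to_nat (Rep_wo y)"
definition "x < y \<longleftrightarrow> to_nat (Rep_wo x) < to_nat (Rep_wo y)"
instance
proof
  fix x y :: "'a wo" show "x \<le> y \<Longrightarrow> y \<le> x \<Longrightarrow> x = y"
    unfolding less_eq_wo_def by (simp add: Rep_wo_inject)
next
  fix P and a :: "'a wo" assume *: "\<And>x::'a wo. (\<And>y. y < x \<Longrightarrow> P y) \<Longrightarrow> P x"
  show "P a"
    by (induction a rule: measure_induct_rule[of "\<lambda>x. to_nat (Rep_wo x)"]) (use * less_wo_def in blast)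
qed (auto simp: less_eq_wo_def less_wo_def)
end

section \<open>Reindexing coordinates preserves Lebesgue measure\<close>

definition to_wo :: "real ^ 'n::finite \<Rightarrow> real ^ 'n wo" where
  "to_wo x = (\<chi> i. x $ Rep_wo i)"

definition of_wo :: "real ^ 'n wo \<Rightarrow> real ^ 'n::finite" where
  "of_wo x = (\<chi> i. x $ Abs_wo i)"

lemma of_wo_to_wo [simp]: "of_wo (to_wo x) = x" and to_wo_of_wo [simp]: "to_wo (of_wo y) = y"
  by (simp_all add: to_wo_def of_wo_def vec_eq_iff Abs_wo_inverse Rep_wo_inverse)

lemma linear_to_wo: "linear to_wo" and linear_of_wo: "linear of_wo"
  by (auto intro!: linearI simp: to_wo_def of_wo_def vec_eq_iff)

lemma measurable_linear_borel: "linear f \<Longrightarrow> f \<in> borel_measurable borel"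
  for f :: "'a::euclidean_space \<Rightarrow> 'b::euclidean_space"
  by (simp add: borel_measurable_continuous_onI linear_continuous_on linear_conv_bounded_linear)

lemma bij_Rep_wo: "bij_betw Rep_wo UNIV UNIV"
  by (metis Abs_wo_inverse Rep_wo_inverse UNIV_I bij_betw_byWitness subset_UNIV)

lemma CARD_wo [simp]: "CARD('n wo) = CARD('n::finite)"
  using bij_betw_same_card[OF bij_Rep_wo] by simp

text \<open>Lebesgue measure is characterized by its values on boxes. Reindexing maps boxes to boxes
  and only permutes the factors in the product of side lengths.\<close>

lemma distr_to_wo: "distr lborel borel to_wo = (lborel :: (real ^ 'n::finite wo) measure)"
proof (rule lborel_eqI[symmetric])
  fix l u :: "real ^ 'n wo"
  assume le: "\<And>b. b \<in> Basis \<Longrightarrow> l \<bullet> b \<le> u \<bullet> b"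
  have le': "l $ i \<le> u $ i" for i
    using le[of "axis i 1"] by (simp add: inner_axis)
  have pre: "to_wo -` box l u = box (of_wo l) (of_wo u)"
    by (auto simp: mem_box_cart to_wo_def of_wo_def) (metis Abs_wo_inverse Rep_wo_inverse UNIV_I)+
  have "emeasure (distr lborel borel to_wo) (box l u) = emeasure lborel (box (of_wo l) (of_wo u))"
    by (subst emeasure_distr) (auto simp: pre measurable_linear_borel linear_to_wo)
  also have "\<dots> = ennreal (measure lborel (cbox (of_wo l) (of_wo u)))"
    by (metis content_cbox_if emeasure_lborel_box_eq emeasure_lborel_cbox_eq emeasure_lborel_cbox_finite emeasure_eq_ennreal_measure infinity_ennreal_def less_irrefl)
  also have "measure lborel (cbox (of_wo l) (of_wo u)) = (\<Prod>i\<in>UNIV. of_wo u $ i - of_wo l $ i)"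
    by (rule content_cbox_cart) (use le' in \<open>auto simp: interval_ne_empty_cart of_wo_def\<close>)
  also have "\<dots> = (\<Prod>i\<in>UNIV. u $ i - l $ i)"
    by (subst prod.reindex_bij_betw[OF bij_Rep_wo, symmetric]) (simp add: of_wo_def Rep_wo_inverse)
  also have "\<dots> = measure lborel (cbox l u)"
    by (rule content_cbox_cart[symmetric]) (use le' in \<open>auto simp: interval_ne_empty_cart\<close>)
  also have "\<dots> = (\<Prod>b\<in>Basis. (u - l) \<bullet> b)"
    using le by (simp add: content_cbox_cases inner_diff_left)
  finally show "emeasure (distr lborel borel to_wo) (box l u) = ennreal (\<Prod>b\<in>Basis. (u - l) \<bullet> b)" .
qed simp

lemma distr_of_wo: "distr lborel borel of_wo = (lborel :: (real ^ 'n::finite) measure)"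
proof -
  have "distr lborel borel of_wo = distr (distr lborel borel to_wo) borel (of_wo :: _ \<Rightarrow> real ^ 'n)"
    by (simp add: distr_to_wo)
  also have "\<dots> = distr lborel borel (\<lambda>x. x)"
    by (subst distr_distr) (auto simp: measurable_linear_borel linear_to_wo linear_of_wo o_def)
  finally show ?thesis by (simp add: distr_id2)
qed

lemma measure_to_wo:
  assumes "compact S"
  shows "measure lborel (to_wo ` S) = measure lborel S"
proof -
  have "compact (to_wo ` S)"
    using linear_to_wo by (intro compact_continuous_image[OF linear_continuous_on] assms) (simp add: linear_conv_bounded_linear)
  moreover have "to_wo -` to_wo ` S = S"
    by (metis inj_vimage_image_eq inj_on_inverseI of_wo_to_wo)
  ultimately show ?thesis
    by (subst distr_to_wo[symmetric], subst measure_distr)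
       (auto simp: measurable_linear_borel linear_to_wo compact_imp_closed)
qed

section \<open>Volume of a lattice simplex with integral dual vectors\<close>

lemma det_Ints:
  fixes A :: "real ^ 'n ^ 'n"
  assumes "\<And>i j. A $ i $ j \<in> \<int>"
  shows "det A \<in> \<int>"
  unfolding det_def using assms by (intro Ints_sum Ints_mult Ints_prod) auto

text \<open>The rows of \<open>Y\<close> are gradients of the barycentric coordinates. They form an
  integral left inverse of the integral matrix \<open>M\<close> of edge vectors at
  \<open>x0\<close>, so \<open>det M\<close> is a unit of the integers, and the volume is its
  absolute value over the factorial of the dimension.\<close>

lemma measure_unimodular_simplex:
  fixes C :: "(real ^ 'n::finite) set" and f :: "'n \<Rightarrow> real ^ 'n" and Y :: "real ^ 'n ^ 'n"
  assumes C: "finite C" "card C = Suc CARD('n)" "x0 \<in> C" and f: "bij_betw f UNIV (C - {x0})"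
    and int: "\<And>v i. v \<in> C \<Longrightarrow> v $ i \<in> \<int>" "\<And>i j. Y $ i $ j \<in> \<int>"
    and dual: "\<And>i j. Y $ i \<bullet> (f j - x0) = (if i = j then 1 else 0)"
  shows "measure lborel (convex hull C) = 1 / fact CARD('n)"
proof -
  define M :: "real ^ 'n wo ^ 'n wo" where
    "M = (\<chi> i j. to_wo (f (Rep_wo j)) $ i - to_wo x0 $ i)"
  define Z :: "real ^ 'n wo ^ 'n wo" where "Z = (\<chi> i. to_wo (Y $ Rep_wo i))"
  have inj: "inj_on to_wo A" for A :: "(real ^ 'n) set"
    by (metis inj_on_inverseI of_wo_to_wo)
  have fC: "f j \<in> C" for j
    using f by (auto simp: bij_betw_def)
  have "bij_betw (\<lambda>j. to_wo (f (Rep_wo j))) UNIV (to_wo ` (C - {x0}))"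
    using bij_betw_trans[OF bij_betw_trans[OF bij_Rep_wo f] inj_on_imp_bij_betw[OF inj]]
    by (simp add: o_def)
  moreover have "to_wo ` (C - {x0}) = to_wo ` C - {to_wo x0}"
    using inj[of UNIV] by (auto simp: inj_on_def)
  ultimately have "measure lborel (convex hull (to_wo ` C)) = \<bar>det M\<bar> / fact CARD('n wo)"
    unfolding M_def using C
    by (intro content_simplex) (auto simp: card_image inj)
  moreover have "\<bar>det M\<bar> = 1"
  proof -
    have entry: "(\<Sum>k\<in>UNIV. Z $ i $ k * M $ k $ j) = (if i = j then 1 else 0)" for i j
    proof -
      have "(\<Sum>k\<in>UNIV. Z $ i $ k * M $ k $ j) = (\<Sum>k\<in>UNIV. Y $ Rep_wo i $ k * (f (Rep_wo j) $ k - x0 $ k))"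
        by (subst sum.reindex_bij_betw[OF bij_Rep_wo, symmetric]) (simp add: Z_def M_def to_wo_def)
      also have "\<dots> = Y $ Rep_wo i \<bullet> (f (Rep_wo j) - x0)"
        by (simp add: inner_vec_def)
      finally show ?thesis
        by (simp add: dual Rep_wo_inject)
    qed
    have "Z ** M = mat 1"
      by (simp add: matrix_matrix_mult_def mat_def vec_eq_iff entry)
    then have "det Z * det M = 1"
      by (metis det_I det_mul)
    moreover have "det Z \<in> \<int>" "det M \<in> \<int>"
      using int fC C(3) by (auto intro!: det_Ints Ints_diff simp: Z_def M_def to_wo_def)
    ultimately obtain a b :: int where "det Z = of_int a" "det M = of_int b" "a * b = 1"
      by (metis Ints_cases of_int_1 of_int_eq_iff of_int_mult)
    then show ?thesis
      by (metis abs_mult abs_1 abs_zmult_eq_1 mult.commute of_int_1 of_int_abs)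
  qed
  moreover have "convex hull (to_wo ` C) = to_wo ` (convex hull C)"
    by (simp add: convex_hull_linear_image linear_to_wo)
  moreover have "measure lborel (to_wo ` (convex hull C)) = measure lborel (convex hull C)"
    using C by (intro measure_to_wo finite_imp_compact_convex_hull)
  ultimately show ?thesis
    by simp
qed

text \<open>The determinant of an involution squares to 1, so the change of variables formula gives
  volume factor 1.\<close>

lemma distr_linear_involution_wo:
  fixes g :: "real ^ 'm::{finite,wellorder} \<Rightarrow> real ^ 'm::_"
  assumes g: "linear g" "\<And>x. g (g x) = x"
  shows "distr lborel borel g = lborel"
proof (rule lborel_eqI[symmetric])
  fix l u :: "real ^ 'm::_"
  assume le: "\<And>b. b \<in> Basis \<Longrightarrow> l \<bullet> b \<le> u \<bullet> b"
  have "matrix g ** matrix g = mat 1"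
    using matrix_compose[OF g(1) g(1)] g(2) by (metis (no_types) comp_def eq_id_iff matrix_id_mat_1)
  then have "det (matrix g) * det (matrix g) = 1"
    by (metis det_I det_mul)
  then have det: "\<bar>det (matrix g)\<bar> = 1"
    by (metis abs_mult abs_one abs_mult_self_eq abs_ge_zero mult.commute power2_eq_square power2_eq_imp_eq power_one zero_le_one)
  \<comment> \<open>For an involution preimages are images, which turns the preimage in
    \<open>distr\<close> into the image in \<open>measure_linear_image\<close>.\<close>
  have pre: "g -` box l u = g ` box l u"
    using g(2) by (auto simp: image_iff) metis
  have lm: "box l u \<in> lmeasurable" by simp
  have "emeasure (distr lborel borel g) (box l u) = emeasure lborel (g -` box l u)"
    by (subst emeasure_distr) (auto simp: measurable_linear_borel g)
  also have "\<dots> = emeasure lebesgue (g -` box l u)"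
    using measurable_sets_borel[OF measurable_linear_borel[OF g(1)], of "box l u"] by simp
  also have "\<dots> = ennreal (measure lebesgue (g ` box l u))"
    unfolding pre by (intro emeasure_eq_measure2 measurable_linear_image g lm)
  also have "\<dots> = ennreal (measure lebesgue (box l u))"
    by (simp add: measure_linear_image[OF g(1) lm] det)
  also have "\<dots> = (\<Prod>b\<in>Basis. (u - l) \<bullet> b)"
    using le by (simp add: measure_lborel_box_eq inner_diff_left)
  finally show "emeasure (distr lborel borel g) (box l u) = ennreal (\<Prod>b\<in>Basis. (u - l) \<bullet> b)" .
qed simp

lemma distr_linear_involution:
  fixes g :: "real ^ 'n::finite \<Rightarrow> real ^ 'n"
  assumes g: "linear g" "\<And>x. g (g x) = x"
  shows "distr lborel borel g = lborel"
proof -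
  define G :: "real ^ 'n wo \<Rightarrow> real ^ 'n wo" where "G = to_wo \<circ> g \<circ> of_wo"
  have G: "linear G" unfolding G_def by (intro linear_compose linear_to_wo linear_of_wo g)
  have "distr lborel borel g = distr (distr lborel borel of_wo) borel g"
    by (simp add: distr_of_wo)
  also have "\<dots> = distr lborel borel (g \<circ> of_wo)"
    by (subst distr_distr) (auto simp: measurable_linear_borel linear_of_wo g)
  also have "g \<circ> of_wo = of_wo \<circ> G"
    by (auto simp: G_def)
  also have "distr lborel borel (of_wo \<circ> G) = distr (distr lborel borel G) borel of_wo"
    by (subst distr_distr) (auto simp: measurable_linear_borel linear_of_wo G)
  also have "distr lborel borel G = lborel"
    by (rule distr_linear_involution_wo[OF G]) (simp add: G_def g)
  finally show ?thesis by (simp add: distr_of_wo)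
qed

section \<open>Integrals of affine functions over a simplex\<close>

lemma integrable_on_compact:
  fixes f :: "'a::euclidean_space \<Rightarrow> real"
  assumes "compact S" "continuous_on S f"
  shows "f integrable_on S"
  using borel_integrable_compact[OF assms] set_borel_integral_eq_integral(1)[of S f]
  by (auto simp: set_integrable_def mult.commute indicator_def if_distrib cong: if_cong)

lemma affine_fun_sum:
  fixes y :: "'a::real_inner"
  assumes "sum w C = 1"
  shows "c + y \<bullet> (\<Sum>v\<in>C. w v *\<^sub>R v) = (\<Sum>v\<in>C. w v * (c + y \<bullet> v))"
  using assms by (simp add: inner_sum_right distrib_left sum.distrib flip: sum_distrib_right)

text \<open>The differences to one vertex \<open>v0\<close> are linearly independent, so prescribed
  values on them extend to a linear functional; its gradient is \<open>adjoint g 1\<close>.\<close>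

lemma affine_interpolation:
  fixes C :: "'a::euclidean_space set"
  assumes "\<not> affine_dependent C"
  obtains c y where "\<And>v. v \<in> C \<Longrightarrow> c + y \<bullet> v = h v"
proof (cases "C = {}")
  case False
  then obtain v0 where v0: "v0 \<in> C" by blast
  have "independent ((\<lambda>x. x - v0) ` (C - {v0}))"
    using affine_dependent_iff_dependent2[OF v0] assms by (simp add: image_def)
  then obtain g where g: "linear g" "\<And>b. b \<in> (\<lambda>x. x - v0) ` (C - {v0}) \<Longrightarrow> g b = h (b + v0) - h v0"
    using linear_independent_extend[of _ "\<lambda>b. h (b + v0) - h v0"] by blast
  have "g x = adjoint g 1 \<bullet> x" for x
    using adjoint_works[OF g(1), of x 1] by (simp add: inner_commute)
  then have "h v0 - adjoint g 1 \<bullet> v0 + adjoint g 1 \<bullet> v = h v" if "v \<in> C" for v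
    using g(2)[of "v - v0"] that by (cases "v = v0") (auto simp: inner_diff_right)
  then show ?thesis by (rule that)
qed (use that in auto)

lemma convex_hull_affine_involution:
  fixes \<phi> :: "'a::real_vector \<Rightarrow> 'a"
  assumes aff: "\<And>w x. sum w C = 1 \<Longrightarrow> \<phi> (\<Sum>v\<in>C. w v *\<^sub>R v) = (\<Sum>v\<in>C. w v *\<^sub>R \<phi> v)"
    and C: "finite C" "\<phi> ` C \<subseteq> C" and inv: "\<And>x. \<phi> (\<phi> x) = x"
  shows "\<phi> x \<in> convex hull C \<longleftrightarrow> x \<in> convex hull C"
proof -
  have *: "\<phi> x \<in> convex hull C" if x: "x \<in> convex hull C" for x
  proof -
    obtain w where w: "\<forall>v\<in>C. 0 \<le> w v" "sum w C = 1" "x = (\<Sum>v\<in>C. w v *\<^sub>R v)"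
      using x by (auto simp: convex_hull_finite C)
    have "\<phi> x = (\<Sum>v\<in>C. w v *\<^sub>R \<phi> v)"
      using aff w by simp
    also have "\<dots> \<in> convex hull C"
      using w C hull_subset[of C convex] by (intro convex_sum) auto
    finally show ?thesis .
  qed
  show ?thesis using *[of x] *[of "\<phi> x"] inv by auto
qed

text \<open>As \<open>y\<close> and \<open>d\<close> have inner product -2, the map negates the
  affine function with constant \<open>c\<close> and gradient \<open>y\<close>: it is an oblique
  reflection. Its linear part \<open>g\<close> is an involution, so it preserves Lebesgue measure,
  as does the remaining translation.\<close>

lemma integral_affine_involution:
  fixes f :: "real ^ 'n::finite \<Rightarrow> real" and y d :: "real ^ 'n" and c :: real
  defines "\<phi> \<equiv> \<lambda>x. x + (c + y \<bullet> x) *\<^sub>R d"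
  assumes yd: "y \<bullet> d = -2" and S: "compact S" "\<And>x. \<phi> x \<in> S \<longleftrightarrow> x \<in> S" and f: "continuous_on UNIV f"
  shows "integral S (\<lambda>x. f (\<phi> x)) = integral S f"
proof -
  define g where "g = (\<lambda>x. x + (y \<bullet> x) *\<^sub>R d)"
  have "linear g"
    unfolding g_def by (auto intro!: linearI simp: algebra_simps inner_add_right)
  moreover have "g (g x) = x" for x
    unfolding g_def by (simp add: inner_add_right yd algebra_simps)
  ultimately have dg: "distr lborel borel g = lborel" and gm: "g \<in> borel_measurable borel"
    by (auto intro: distr_linear_involution measurable_linear_borel)
  have \<phi>g: "\<phi> = (\<lambda>x. c *\<^sub>R d + x) \<circ> g"
    by (auto simp: \<phi>_def g_def algebra_simps)
  have "distr lborel borel \<phi> = distr (distr lborel borel g) borel (\<lambda>x. c *\<^sub>R d + x)"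
    unfolding \<phi>g by (subst distr_distr) (auto simp: gm)
  also have "\<dots> = lborel"
    by (simp add: dg lborel_distr_plus)
  finally have d\<phi>: "distr lborel borel \<phi> = lborel" .
  have \<phi>c: "continuous_on UNIV \<phi>" unfolding \<phi>_def by (intro continuous_intros)
  then have \<phi>m: "\<phi> \<in> borel_measurable borel" by (rule borel_measurable_continuous_onI)
  have fm: "f \<in> borel_measurable borel" using f by (rule borel_measurable_continuous_onI)
  have int: "(LINT x:S|lborel. h x) = integral S h" if "continuous_on UNIV h" for h :: "real ^ 'n \<Rightarrow> real"
    using that S(1) borel_integrable_compact[of S h] continuous_on_subset[of UNIV h S]
    by (intro set_borel_integral_eq_integral) (auto simp: set_integrable_def mult.commute indicator_def if_distrib cong: if_cong)
  have [measurable]: "S \<in> sets borel" using S(1) by (simp add: compact_imp_closed)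
  have "integral S f = (LINT x:S|distr lborel borel \<phi>. f x)"
    by (simp add: d\<phi> int f)
  also have "\<dots> = (LINT x:S|lborel. f (\<phi> x))"
    unfolding set_lebesgue_integral_def
    by (subst integral_distr) (use \<phi>m fm in \<open>auto simp: S(2) indicator_def\<close>)
  also have "\<dots> = integral S (\<lambda>x. f (\<phi> x))"
    by (intro int continuous_on_compose2[OF f \<phi>c]) auto
  finally show ?thesis ..
qed

text \<open>Exchanging two vertices is an affine reflection of the simplex, so all barycentric
  coordinates have the same integral. They sum to 1, hence each integral is the volume divided by
  the number of vertices.\<close>

lemma has_integral_affine_simplex:
  fixes C :: "(real ^ 'n::finite) set"
  assumes ind: "\<not> affine_dependent C"
  shows "((\<lambda>x. c + y \<bullet> x) has_integral
      measure lborel (convex hull C) / card C * (\<Sum>v\<in>C. c + y \<bullet> v)) (convex hull C)"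
proof (cases "C = {}")
  case False
  have fin: "finite C" using ind by (rule aff_independent_finite)
  define S where "S = convex hull C"
  have comp: "compact S" unfolding S_def by (rule finite_imp_compact_convex_hull[OF fin])
  have "\<exists>a b. \<forall>v\<in>C. a + b \<bullet> v = (if v = u then 1 else 0)" for u
    by (rule affine_interpolation[OF ind, of "\<lambda>v. if v = u then 1 else 0"]) blast
  \<comment> \<open>On the simplex, the affine function with coefficients \<open>a u\<close> and
    \<open>b u\<close> is the barycentric coordinate of the vertex \<open>u\<close>.\<close>
  then obtain a b where ab: "\<And>u v. v \<in> C \<Longrightarrow> a u + b u \<bullet> v = (if v = u then 1 else (0::real))"
    by metis
  have cont: "continuous_on A (\<lambda>x. r + z \<bullet> x)" for r :: real and z :: "real ^ 'n" and A
    by (intro continuous_intros)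
  have int: "(\<lambda>x. r + z \<bullet> x) integrable_on S" for r :: real and z :: "real ^ 'n"
    using comp cont by (rule integrable_on_compact)
  have swap: "integral S (\<lambda>x. a u + b u \<bullet> x) = integral S (\<lambda>x. a v + b v \<bullet> x)"
    if uv: "u \<in> C" "v \<in> C" "u \<noteq> v" for u v
  proof -
    \<comment> \<open>The function built from \<open>?c\<close> and \<open>?y\<close> is 1 at
      \<open>u\<close>, -1 at \<open>v\<close> and 0 at the other vertices, so moving along
      \<open>?d\<close> by its value exchanges \<open>u\<close> and \<open>v\<close> and fixes the
      rest.\<close>
    let ?c = "a u - a v" and ?y = "b u - b v" and ?d = "v - u"
    let ?\<phi> = "\<lambda>x. x + (?c + ?y \<bullet> x) *\<^sub>R ?d"
    have yd: "b u \<bullet> ?d = -1" "b v \<bullet> ?d = 1"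
      using ab[OF uv(1), of u] ab[OF uv(2), of u] ab[OF uv(1), of v] ab[OF uv(2), of v] uv
      by (auto simp: inner_diff_right)
    have "?\<phi> x \<in> S \<longleftrightarrow> x \<in> S" for x
      unfolding S_def
    proof (rule convex_hull_affine_involution[where \<phi> = ?\<phi>])
      show "?\<phi> (\<Sum>v\<in>C. w v *\<^sub>R v) = (\<Sum>v\<in>C. w v *\<^sub>R ?\<phi> v)" if "sum w C = 1" for w
        by (simp add: affine_fun_sum[OF that] scaleR_add_right sum.distrib scaleR_sum_left)
      have "?c + ?y \<bullet> w = (if w = u then 1 else if w = v then -1 else 0)" if "w \<in> C" for w
        using ab[OF that, of u] ab[OF that, of v] uv by (auto simp: inner_diff_left)
      then show "?\<phi> ` C \<subseteq> C"
        using uv by auto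
      show "?\<phi> (?\<phi> x) = x" for x
      proof -
        have "?y \<bullet> ?d = -2" using yd by (simp add: inner_diff_left)
        then have "?c + ?y \<bullet> ?\<phi> x = - (?c + ?y \<bullet> x)" by (simp only: inner_add_right inner_scaleR_right) simp
        then show ?thesis by (simp only: scaleR_minus_left add.assoc right_minus add_0_right)
      qed
    qed (rule fin)
    from integral_affine_involution[OF _ comp this cont, of "a u" "b u"] yd
    have "integral S (\<lambda>x. a u + b u \<bullet> ?\<phi> x) = integral S (\<lambda>x. a u + b u \<bullet> x)"
      by (simp add: inner_diff_left)
    moreover have "a u + b u \<bullet> ?\<phi> x = a v + b v \<bullet> x" for x
      using yd(1) by (simp add: inner_add_right inner_diff_left)
    ultimately show ?thesis by simp
  qed
  have repr: "r + z \<bullet> x = (\<Sum>u\<in>C. (r + z \<bullet> u) * (a u + b u \<bullet> x))" if "x \<in> S" for r x and z :: "real ^ 'n"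
  proof -
    obtain w where w: "sum w C = 1" "(\<Sum>v\<in>C. w v *\<^sub>R v) = x"
      using \<open>x \<in> S\<close> unfolding S_def convex_hull_finite[OF fin] by blast
    have "a u + b u \<bullet> x = w u" if "u \<in> C" for u
      using that unfolding w(2)[symmetric] affine_fun_sum[OF w(1)] by (simp add: ab if_distrib fin cong: if_cong)
    then show ?thesis
      unfolding w(2)[symmetric] affine_fun_sum[OF w(1)] using w(2) by (simp add: mult.commute)
  qed
  obtain u0 where u0: "u0 \<in> C" using False by blast
  define I where "I = integral S (\<lambda>x. a u0 + b u0 \<bullet> x)"
  have I: "((\<lambda>x. a u + b u \<bullet> x) has_integral I) S" if "u \<in> C" for u
    using swap[OF that u0] int[of "a u" "b u"] unfolding I_def by (metis integrable_integral)
  have gen: "((\<lambda>x. r + z \<bullet> x) has_integral (\<Sum>u\<in>C. (r + z \<bullet> u) * I)) S" for r and z :: "real ^ 'n"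
  proof (rule has_integral_eq)
    show "((\<lambda>x. \<Sum>u\<in>C. (r + z \<bullet> u) * (a u + b u \<bullet> x)) has_integral (\<Sum>u\<in>C. (r + z \<bullet> u) * I)) S"
      by (intro has_integral_sum fin has_integral_mult_right I)
  qed (simp add: repr)
  \<comment> \<open>The constant function 1 determines the common integral \<open>I\<close>.\<close>
  have "((\<lambda>x. 1) has_integral card C * I) S"
    using gen[of 1 0] by simp
  moreover have "((\<lambda>x. 1) has_integral measure lborel S) S"
    using comp has_integral_measure_lborel[of S] emeasure_compact_finite[OF comp] compact_imp_closed[OF comp] by auto
  ultimately have "measure lborel S = card C * I"
    using has_integral_unique by blast
  then have "I = measure lborel S / card C"
    using False fin by (simp add: field_simps)
  with gen[of c y] show ?thesis
    by (simp add: S_def sum_distrib_left mult.commute sum_divide_distrib)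
qed simp

subsection \<open>Lower envelopes\<close>

text \<open>In a convex combination on the supporting hyperplane, points strictly above it would
  raise the value, so they carry weight 0.\<close>

lemma convex_hull_supporting:
  fixes W :: "'a::real_inner set"
  assumes fin: "finite W" and le: "\<And>w. w \<in> W \<Longrightarrow> b \<le> d \<bullet> w" and z: "z \<in> convex hull W" "d \<bullet> z = b"
  shows "z \<in> convex hull {w \<in> W. d \<bullet> w = b}"
proof -
  obtain u where u: "\<And>w. w \<in> W \<Longrightarrow> 0 \<le> u w" "sum u W = 1" "(\<Sum>w\<in>W. u w *\<^sub>R w) = z"
    using z(1) unfolding convex_hull_finite[OF fin] by blast
  have "(\<Sum>w\<in>W. u w * (d \<bullet> w - b)) = 0"
    using affine_fun_sum[OF u(2), of "-b" d] z(2) by (simp add: u(3))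
  then have "\<forall>w\<in>W. u w * (d \<bullet> w - b) = 0"
    using fin u(1) le by (subst (asm) sum_nonneg_eq_0_iff) auto
  then have zero: "\<forall>w\<in>W. u w = 0 \<or> d \<bullet> w = b"
    by auto
  have "sum u {w \<in> W. d \<bullet> w = b} = 1" "(\<Sum>w | w \<in> W \<and> d \<bullet> w = b. u w *\<^sub>R w) = z"
    unfolding u(2,3)[symmetric] using fin zero by (auto intro!: sum.mono_neutral_left)
  then show ?thesis
    using u(1) fin by (auto simp: convex_hull_finite)
qed

lemma affine_fun_le_convex_hull:
  fixes y :: "'a::real_inner"
  assumes "x \<in> convex hull W" "\<And>w. w \<in> W \<Longrightarrow> c + y \<bullet> w \<le> c' + y' \<bullet> w"
  shows "c + y \<bullet> x \<le> c' + y' \<bullet> x"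
proof -
  have "convex hull W \<subseteq> {x. (y - y') \<bullet> x \<le> c' - c}"
    using assms(2) by (intro hull_minimal convex_halfspace_le) (auto simp: inner_diff_left algebra_simps)
  then show ?thesis
    using assms(1) by (auto simp: inner_diff_left algebra_simps)
qed

text \<open>Lower faces of the lifted polytope correspond to affine minorants of the heights, given
  by a constant \<open>c\<close> and a gradient \<open>y\<close>; the tight points are the vertices
  of \<open>V\<close> under such a face.\<close>

definition tight :: "'a::euclidean_space set \<Rightarrow> ('a \<Rightarrow> real) \<Rightarrow> real \<Rightarrow> 'a \<Rightarrow> 'a set" where
  "tight V h c y = {v \<in> V. c + y \<bullet> v = h v}"

definition below :: "'a::euclidean_space set \<Rightarrow> ('a \<Rightarrow> real) \<Rightarrow> real \<Rightarrow> 'a \<Rightarrow> bool" where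
  "below V h c y \<longleftrightarrow> (\<forall>v\<in>V. c + y \<bullet> v \<le> h v)"

lemma tight_subset: "tight V h c y \<subseteq> V"
  by (auto simp: tight_def)

text \<open>The face lies in the graph of an affine function over its projection, so projecting
  loses no dimension. The functional \<open>(c, 1)\<close> with minimum \<open>b\<close> corresponds
  to the minorant with constant \<open>b\<close> and gradient \<open>- c\<close>, whence the
  sign.\<close>

lemma lower_face_eq:
  fixes V :: "'a::euclidean_space set"
  assumes fin: "finite V" and K: "K = convex hull ((\<lambda>v. (v, h v)) ` V)"
    and bel: "\<forall>(x, t)\<in>K. b \<le> c \<bullet> x + t"
  defines "F \<equiv> {(x, t). (x, t) \<in> K \<and> c \<bullet> x + t = b}"
  shows "fst ` F = convex hull (tight V h b (- c))"
    and "aff_dim F = aff_dim (tight V h b (- c))"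
proof -
  let ?W = "(\<lambda>v. (v, h v)) ` V" and ?d = "(c, 1 :: real)"
  let ?g = "\<lambda>x. (x, b - c \<bullet> x)"
  have W: "b \<le> ?d \<bullet> w" if "w \<in> ?W" for w
    using bel hull_inc[OF that, of convex] K by (cases w) fastforce
  have eq: "{w \<in> ?W. ?d \<bullet> w = b} = ?g ` tight V h b (- c)"
    by (auto simp: tight_def image_iff)
  have "F = convex hull (?g ` tight V h b (- c))"
  proof
    show "F \<subseteq> convex hull (?g ` tight V h b (- c))"
    proof
      fix z assume z: "z \<in> F"
      then have "z \<in> convex hull ?W" "?d \<bullet> z = b" by (auto simp: F_def K)
      from convex_hull_supporting[OF finite_imageI[OF fin] W this]
      show "z \<in> convex hull (?g ` tight V h b (- c))" unfolding eq .
    qed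
    have "convex F"
    proof -
      have "F = K \<inter> {z. ?d \<bullet> z = b}" by (auto simp: F_def)
      then show ?thesis unfolding K by (auto intro: convex_Int convex_hyperplane)
    qed
    moreover have "?g ` tight V h b (- c) \<subseteq> F"
      unfolding eq[symmetric] F_def K by (auto intro: hull_inc)
    ultimately show "convex hull (?g ` tight V h b (- c)) \<subseteq> F"
      by (rule hull_minimal[rotated])
  qed
  then show "fst ` F = convex hull (tight V h b (- c))"
    by (simp add: convex_hull_linear_image[OF linear_fst] image_image)
  have lin: "linear (\<lambda>x. (x, - (c \<bullet> x)))" "inj (\<lambda>x. (x, - (c \<bullet> x)))"
    by (auto intro!: linearI injI simp: inner_add_right)
  have "aff_dim F = aff_dim (?g ` tight V h b (- c))"
    by (simp add: \<open>F = _\<close> aff_dim_convex_hull)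
  also have "?g ` tight V h b (- c) = (\<lambda>x. (0, b) + x) ` (\<lambda>x. (x, - (c \<bullet> x))) ` tight V h b (- c)"
    by (simp add: image_image)
  also have "aff_dim \<dots> = aff_dim (tight V h b (- c))"
    by (simp only: aff_dim_translation_eq aff_dim_injective_linear_image[OF lin])
  finally show "aff_dim F = aff_dim (tight V h b (- c))" .
qed

lemma lower_envelope_projection_eq:
  fixes P :: "'a::euclidean_space set"
  assumes fin: "finite V" and V: "V = polytope_vertices P"
  shows "lower_envelope_projection P h =
    {convex hull (tight V h c y) | c y. below V h c y \<and> aff_dim (tight V h c y) = int DIM('a)}"
proof -
  define K where "K = convex hull ((\<lambda>v. (v, h v)) ` V)"
  have K': "lifted_polytope P h = K"
    by (simp add: lifted_polytope_def K_def V)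
  have bel: "(\<forall>(x, t)\<in>K. b \<le> c \<bullet> x + t) \<longleftrightarrow> below V h b (- c)" for b c
  proof
    assume "\<forall>(x, t)\<in>K. b \<le> c \<bullet> x + t"
    moreover have "(v, h v) \<in> K" if "v \<in> V" for v
      unfolding K_def using that by (auto intro: hull_inc)
    ultimately show "below V h b (- c)"
      by (fastforce simp: below_def)
  next
    assume *: "below V h b (- c)"
    have "K \<subseteq> {z. (c, 1) \<bullet> z \<ge> b}"
      unfolding K_def using * by (intro hull_minimal convex_halfspace_ge) (auto simp: below_def)
    then show "\<forall>(x, t)\<in>K. b \<le> c \<bullet> x + t" by auto
  qed
  show ?thesis
  proof (intro set_eqI iffI)
    fix S assume "S \<in> lower_envelope_projection P h"
    then obtain c b where cb: "\<forall>(x, t)\<in>K. b \<le> c \<bullet> x + t"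
      and S: "S = fst ` {(x, t). (x, t) \<in> K \<and> c \<bullet> x + t = b}"
      and ad: "aff_dim {(x, t). (x, t) \<in> K \<and> c \<bullet> x + t = b} = int DIM('a)"
      unfolding lower_envelope_projection_def lower_face_of_def K' by blast
    have "S = convex hull (tight V h b (- c))" "aff_dim (tight V h b (- c)) = int DIM('a)"
      using lower_face_eq[OF fin K_def cb] S ad by auto
    with cb bel show "S \<in> {convex hull (tight V h c y) | c y. below V h c y \<and> aff_dim (tight V h c y) = int DIM('a)}"
      by blast
  next
    fix S assume "S \<in> {convex hull (tight V h c y) | c y. below V h c y \<and> aff_dim (tight V h c y) = int DIM('a)}"
    then obtain b y where S: "S = convex hull (tight V h b y)" "below V h b y" "aff_dim (tight V h b y) = int DIM('a)"
      by blast
    define c where "c = - y"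
    have cb: "\<forall>(x, t)\<in>K. b \<le> c \<bullet> x + t"
      using S(2) bel[of b c] by (simp add: c_def)
    note * = lower_face_eq[OF fin K_def cb]
    let ?F = "{(x, t). (x, t) \<in> K \<and> c \<bullet> x + t = b}"
    have "lower_face_of ?F K" using cb unfolding lower_face_of_def by blast
    moreover have "S = fst ` ?F" "aff_dim ?F = int DIM('a)" using * S by (simp_all add: c_def)
    ultimately show "S \<in> lower_envelope_projection P h"
      unfolding lower_envelope_projection_def K' by blast
  qed
qed

section \<open>Full-dimensional cells over points in general position\<close>

lemma interior_nonempty_aff_dim:
  fixes S :: "'a::euclidean_space set"
  assumes "convex S" "aff_dim S = int DIM('a)"
  shows "interior S \<noteq> {}"
  using assms by (metis aff_dim_empty aff_dim_eq_full int_ops(1) of_nat_0_le_iff neg_0_le_iff_le not_one_le_zero rel_interior_eq_empty rel_interior_interior)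

text \<open>These weights put one unit on \<open>v\<close> and take away its affine representation
  over \<open>B\<close>. Choosing \<open>f\<close> as 1, the identity and the heights shows that the
  total weight and the barycenter do not change, and gives the change of height.\<close>

lemma sum_exchange:
  fixes f :: "'a \<Rightarrow> 'b::real_vector"
  assumes "finite V" "v \<in> V" "B \<subseteq> V"
  shows "(\<Sum>w\<in>V. ((if w = v then 1 else 0) - (if w \<in> B then \<alpha> w else 0)) *\<^sub>R f w) = f v - (\<Sum>b\<in>B. \<alpha> b *\<^sub>R f b)"
proof -
  have "(\<Sum>w\<in>V. ((if w = v then 1 else 0) - (if w \<in> B then \<alpha> w else 0)) *\<^sub>R f w)
      = (\<Sum>w\<in>V. if w = v then f w else 0) - (\<Sum>w\<in>V. if w \<in> B then \<alpha> w *\<^sub>R f w else 0)"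
    by (subst sum_subtractf[symmetric]) (auto intro!: sum.cong simp: algebra_simps)
  also have "(\<Sum>w\<in>V. if w \<in> B then \<alpha> w *\<^sub>R f w else 0) = (\<Sum>b\<in>B. \<alpha> b *\<^sub>R f b)"
    using assms by (subst sum.inter_restrict[symmetric]) (auto simp: Int_absorb1)
  finally show ?thesis using assms by simp
qed

text \<open>The cell through a point x outside all affine hulls of smaller dimension comes from an optimal
  convex combination of the lifted points over x: its support spans, and moving weight between an affine basis of the
  support and any other vertex cannot lower the height.\<close>

lemma lower_cell_exists:
  fixes V :: "'a::euclidean_space set"
  assumes fin: "finite V" and x: "x \<in> convex hull V"
    and gen: "\<And>W. W \<subseteq> V \<Longrightarrow> x \<in> affine hull W \<Longrightarrow> aff_dim W = int DIM('a)"
  obtains c y where "below V h c y" "aff_dim (tight V h c y) = int DIM('a)" "x \<in> convex hull (tight V h c y)"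
proof -
  let ?feas = "\<lambda>\<mu>. (\<forall>v\<in>V. 0 \<le> \<mu> v) \<and> sum \<mu> V = 1 \<and> (\<Sum>v\<in>V. \<mu> v *\<^sub>R v) = x"
  let ?val = "\<lambda>\<mu>. \<Sum>v\<in>V. \<mu> v * h v"
  define K where "K = convex hull ((\<lambda>v. (v, h v)) ` V)"
  have inj: "inj_on (\<lambda>v. (v, h v)) V" by (auto simp: inj_on_def)
  have K: "(x, t) \<in> K \<longleftrightarrow> (\<exists>\<mu>. ?feas \<mu> \<and> ?val \<mu> = t)" for t
  proof
    assume "(x, t) \<in> K"
    then obtain u where u: "\<forall>w\<in>(\<lambda>v. (v, h v)) ` V. 0 \<le> u w" "sum u ((\<lambda>v. (v, h v)) ` V) = 1"
      "(\<Sum>w\<in>(\<lambda>v. (v, h v)) ` V. u w *\<^sub>R w) = (x, t)"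
      unfolding K_def by (subst (asm) convex_hull_finite) (use fin in auto)
    then show "\<exists>\<mu>. ?feas \<mu> \<and> ?val \<mu> = t"
      by (intro exI[of _ "\<lambda>v. u (v, h v)"]) (auto simp: sum.reindex[OF inj] prod_eq_iff fst_sum snd_sum)
  next
    assume "\<exists>\<mu>. ?feas \<mu> \<and> ?val \<mu> = t"
    then obtain \<mu> where \<mu>: "?feas \<mu>" "?val \<mu> = t" by blast
    have "(\<Sum>v\<in>V. \<mu> v *\<^sub>R (v, h v)) \<in> K"
      unfolding K_def using \<mu> fin by (intro convex_sum) (auto intro: hull_inc)
    moreover have "(\<Sum>v\<in>V. \<mu> v *\<^sub>R (v, h v)) = (x, t)"
      using \<mu> by (auto simp: prod_eq_iff fst_sum snd_sum)
    ultimately show "(x, t) \<in> K" by simp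
  qed
  have "compact (K \<inter> {x} \<times> UNIV)"
    unfolding K_def using fin
    by (intro compact_Int_closed finite_imp_compact_convex_hull closed_Times) auto
  moreover have "K \<inter> {x} \<times> UNIV \<noteq> {}"
  proof -
    obtain \<mu> where "?feas \<mu>" using x unfolding convex_hull_finite[OF fin] by blast
    then have "(x, ?val \<mu>) \<in> K" using K by blast
    then show ?thesis by blast
  qed
  ultimately obtain z where z: "z \<in> K \<inter> {x} \<times> UNIV" "\<forall>z'\<in>K \<inter> {x} \<times> UNIV. snd z \<le> snd z'"
    using continuous_attains_inf[OF _ _ continuous_on_snd[OF continuous_on_id]] by blast
  define t0 where "t0 = snd z"
  have t0: "(x, t0) \<in> K" "(x, t) \<in> K \<Longrightarrow> t0 \<le> t" for t
    using z(1) z(2)[rule_format, of "(x, t)"] by (cases z; simp add: t0_def)+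
  from t0(1) obtain \<mu> where \<mu>: "?feas \<mu>" "?val \<mu> = t0" using K by blast
  have opt: "t0 \<le> ?val \<nu>" if "?feas \<nu>" for \<nu>
    using t0(2) K that by blast
  \<comment> \<open>The support of an optimal combination. Since \<open>x\<close> lies in its hull,
    \<open>gen\<close> makes it full-dimensional, so an affine basis \<open>B\<close> of it
    determines the affine function of the cell.\<close>
  define U where "U = {v \<in> V. \<mu> v > 0}"
  have U: "U \<subseteq> V" by (auto simp: U_def)
  have xU: "x \<in> convex hull U"
  proof -
    have "\<forall>v\<in>V - U. \<mu> v = 0" using \<mu>(1) by (force simp: U_def)
    then have "sum \<mu> U = sum \<mu> V" "(\<Sum>v\<in>U. \<mu> v *\<^sub>R v) = (\<Sum>v\<in>V. \<mu> v *\<^sub>R v)"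
      using fin U by (auto intro!: sum.mono_neutral_left)
    then have "sum \<mu> U = 1" "(\<Sum>v\<in>U. \<mu> v *\<^sub>R v) = x" using \<mu>(1) by simp_all
    then show ?thesis
      unfolding convex_hull_finite[OF finite_subset[OF U fin]] by (auto simp: U_def less_imp_le intro!: exI[of _ \<mu>])
  qed
  then have adU: "aff_dim U = int DIM('a)"
    using gen[OF U] convex_hull_subset_affine_hull by blast
  obtain B where B: "\<not> affine_dependent B" "B \<subseteq> U" "affine hull U = affine hull B"
    using affine_basis_exists by blast
  have finB: "finite B" using B(1) aff_independent_finite by blast
  have BU: "affine hull B = UNIV"
    using adU B(3) by (simp add: aff_dim_eq_full)
  obtain c y where cy: "\<And>v. v \<in> B \<Longrightarrow> c + y \<bullet> v = h v"
    using affine_interpolation[OF B(1), of h] by blast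
  \<comment> \<open>A direction that is negative only on the support stays nonnegative for a small
    step; the minimum over the finite set \<open>V\<close> gives a common step size.\<close>
  have move: "\<exists>\<epsilon>>0. \<forall>v\<in>V. 0 \<le> \<mu> v + \<epsilon> * d v" if pos: "\<And>v. v \<in> V \<Longrightarrow> d v < 0 \<Longrightarrow> \<mu> v > 0" for d
  proof -
    have "\<exists>e>0. \<forall>t. 0 \<le> t \<and> t \<le> e \<longrightarrow> 0 \<le> \<mu> v + t * d v" if v: "v \<in> V" for v
    proof (cases "d v < 0")
      case True
      have "0 \<le> \<mu> v + t * d v" if "0 \<le> t" "t \<le> \<mu> v / - d v" for t
      proof -
        have "t * - d v \<le> \<mu> v" using that True pos_le_divide_eq[of "- d v" t "\<mu> v"] by simp
        then show ?thesis by simp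
      qed
      then show ?thesis
        using pos[OF v True] True by (intro exI[of _ "\<mu> v / - d v"]) (auto simp: divide_pos_neg)
    next
      case False
      then have "0 \<le> \<mu> v + t * d v" if "0 \<le> t" for t using \<mu>(1) v that by simp
      then show ?thesis using zero_less_one by blast
    qed
    then obtain e where e: "\<And>v. v \<in> V \<Longrightarrow> e v > 0 \<and> (\<forall>t. 0 \<le> t \<and> t \<le> e v \<longrightarrow> 0 \<le> \<mu> v + t * d v)"
      by metis
    have "Min (insert 1 (e ` V)) > 0"
      using fin e by (subst Min_gr_iff) auto
    moreover have "Min (insert 1 (e ` V)) \<le> e v" if "v \<in> V" for v
      using fin that by (intro Min_le) auto
    ultimately show ?thesis
      using e by (intro exI[of _ "Min (insert 1 (e ` V))"]) (auto intro: less_imp_le)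
  qed
  have dir: "0 \<le> (\<Sum>v\<in>V. d v * h v)"
    if d: "\<And>v. v \<in> V \<Longrightarrow> d v < 0 \<Longrightarrow> \<mu> v > 0" "sum d V = 0" "(\<Sum>v\<in>V. d v *\<^sub>R v) = 0" for d
  proof -
    obtain \<epsilon> where \<epsilon>: "\<epsilon> > 0" "\<forall>v\<in>V. 0 \<le> \<mu> v + \<epsilon> * d v"
      using move[of d] d(1) by blast
    have "?feas (\<lambda>v. \<mu> v + \<epsilon> * d v)"
    proof (intro conjI)
      show "(\<Sum>v\<in>V. \<mu> v + \<epsilon> * d v) = 1"
        using \<mu>(1) d(2) by (simp add: sum.distrib flip: sum_distrib_left)
      have "(\<Sum>v\<in>V. (\<mu> v + \<epsilon> * d v) *\<^sub>R v) = (\<Sum>v\<in>V. \<mu> v *\<^sub>R v) + \<epsilon> *\<^sub>R (\<Sum>v\<in>V. d v *\<^sub>R v)"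
        by (simp add: scaleR_add_left sum.distrib scaleR_sum_right)
      then show "(\<Sum>v\<in>V. (\<mu> v + \<epsilon> * d v) *\<^sub>R v) = x"
        using \<mu>(1) d(3) by simp
    qed (use \<epsilon>(2) in blast)
    from opt[OF this] have "0 \<le> \<epsilon> * (\<Sum>v\<in>V. d v * h v)"
      using \<mu>(2) by (simp add: sum.distrib distrib_right sum_distrib_left mult.assoc)
    then show ?thesis using \<epsilon>(1) by (simp add: zero_le_mult_iff)
  qed
  \<comment> \<open>The exchange direction takes weight only from \<open>B\<close>, inside the
    support, so optimality gives the minorant property at \<open>v\<close>. For \<open>v\<close> in
    the support the reverse direction is admissible too, which gives equality.\<close>
  have both: "c + y \<bullet> v \<le> h v \<and> (v \<in> U \<longrightarrow> h v \<le> c + y \<bullet> v)" if v: "v \<in> V" for v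
  proof -
    have "v \<in> affine hull B" by (simp add: BU)
    then obtain \<alpha> where \<alpha>: "sum \<alpha> B = 1" "(\<Sum>b\<in>B. \<alpha> b *\<^sub>R b) = v"
      unfolding affine_hull_finite[OF finB] by blast
    define d where "d w = (if w = v then 1 else 0) - (if w \<in> B then \<alpha> w else 0)" for w
    have BV: "B \<subseteq> V" using B(2) U by blast
    have sums: "sum d V = 0" "(\<Sum>w\<in>V. d w *\<^sub>R w) = 0"
      using sum_exchange[OF fin v BV, of \<alpha> "\<lambda>_. 1 :: real"] sum_exchange[OF fin v BV, of \<alpha> "\<lambda>w. w"] \<alpha>
      by (simp_all add: d_def)
    have "(\<Sum>b\<in>B. \<alpha> b * h b) = c + y \<bullet> v"
      using affine_fun_sum[OF \<alpha>(1), of c y] cy by (simp add: \<alpha>(2))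
    then have val: "(\<Sum>w\<in>V. d w * h w) = h v - (c + y \<bullet> v)"
      using sum_exchange[OF fin v BV, of \<alpha> h] by (simp add: d_def)
    have "0 \<le> (\<Sum>w\<in>V. d w * h w)"
      using B(2) sums by (intro dir) (auto simp: d_def U_def split: if_splits)
    moreover have "0 \<le> (\<Sum>w\<in>V. - d w * h w)" if "v \<in> U"
    proof (rule dir)
      show "(\<Sum>w\<in>V. - d w) = 0" "(\<Sum>w\<in>V. - d w *\<^sub>R w) = 0"
        using sums by (simp_all add: sum_negf)
    qed (use B(2) that in \<open>auto simp: d_def U_def split: if_splits\<close>)
    ultimately show ?thesis using val by (auto simp: sum_negf)
  qed
  have "U \<subseteq> tight V h c y"
    using both U by (force simp: tight_def)
  moreover from this have "aff_dim U \<le> aff_dim (tight V h c y)" by (rule aff_dim_subset)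
  ultimately show ?thesis
    using xU adU hull_mono[of U "tight V h c y" convex] aff_dim_le_DIM[of "tight V h c y"] both
    by (intro that[of c y]) (auto simp: below_def)
qed

section \<open>Generic heights and the triangulations they induce\<close>

definition generic_height :: "'a::euclidean_space set \<Rightarrow> ('a \<Rightarrow> real) \<Rightarrow> bool" where
  "generic_height V h \<longleftrightarrow> (\<forall>c y. \<not> affine_dependent (tight V h c y))"

text \<open>On the tight points of either minorant the other one is not larger, so the two agree at
  every common point \<open>x\<close>. Hence \<open>x\<close> lies in the face of the first cell on
  which they agree, and the vertices of this face are tight for both.\<close>

lemma tight_cells_Int:
  fixes V :: "'a::euclidean_space set"
  assumes fin: "finite V" and bel: "below V h c y" "below V h c' y'"
  shows "convex hull (tight V h c y) \<inter> convex hull (tight V h c' y') = convex hull (tight V h c y \<inter> tight V h c' y')"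
proof
  show "convex hull (tight V h c y \<inter> tight V h c' y') \<subseteq> convex hull (tight V h c y) \<inter> convex hull (tight V h c' y')"
    by (simp add: hull_mono)
  show "convex hull (tight V h c y) \<inter> convex hull (tight V h c' y') \<subseteq> convex hull (tight V h c y \<inter> tight V h c' y')"
  proof
    fix x assume x: "x \<in> convex hull (tight V h c y) \<inter> convex hull (tight V h c' y')"
    have le: "c' + y' \<bullet> w \<le> c + y \<bullet> w" if "w \<in> tight V h c y" for w
      using that bel(2) by (auto simp: tight_def below_def)
    have le': "c + y \<bullet> w \<le> c' + y' \<bullet> w" if "w \<in> tight V h c' y'" for w
      using that bel(1) by (auto simp: tight_def below_def)
    have "c + y \<bullet> x = c' + y' \<bullet> x"
      using affine_fun_le_convex_hull[OF _ le] affine_fun_le_convex_hull[OF _ le'] x by (meson IntD1 IntD2 antisym)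
    then have "(y - y') \<bullet> x = c' - c" by (simp add: inner_diff_left)
    moreover have "finite (tight V h c y)" using finite_subset[OF tight_subset fin] .
    moreover have "c' - c \<le> (y - y') \<bullet> w" if "w \<in> tight V h c y" for w
      using le[OF that] by (simp add: inner_diff_left)
    ultimately have "x \<in> convex hull {w \<in> tight V h c y. (y - y') \<bullet> w = c' - c}"
      using x by (intro convex_hull_supporting) auto
    moreover have "{w \<in> tight V h c y. (y - y') \<bullet> w = c' - c} \<subseteq> tight V h c y \<inter> tight V h c' y'"
      by (auto simp: tight_def inner_diff_left)
    ultimately show "x \<in> convex hull (tight V h c y \<inter> tight V h c' y')"
      using hull_mono by blast
  qed
qed

text \<open>The part of the interior missed by \<open>U\<close> is open and negligible, hence empty;
  a convex set with nonempty interior lies in the closure of its interior.\<close>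

lemma closed_cover_generic:
  fixes P :: "'a::euclidean_space set"
  assumes "convex P" "interior P \<noteq> {}" "closed U" "negligible N" "P - N \<subseteq> U"
  shows "P \<subseteq> U"
proof -
  have "interior P - U \<subseteq> N" using assms(5) interior_subset by blast
  moreover have "open (interior P - U)" using assms(3) by (simp add: open_Diff)
  ultimately have "interior P - U = {}"
    using assms(4) negligible_subset open_not_negligible by blast
  then have "closure (interior P) \<subseteq> U"
    using assms(3) closure_minimal by blast
  then show ?thesis
    using convex_closure_interior[OF assms(1,2)] closure_subset by blast
qed

lemma lower_envelope_projection_covers:
  fixes P :: "'a::euclidean_space set"
  assumes fin: "finite V" and V: "V = polytope_vertices P" and P: "P = convex hull V" "aff_dim P = int DIM('a)"
  shows "\<Union>(lower_envelope_projection P h) = P"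
proof
  let ?T = "lower_envelope_projection P h"
  note T = lower_envelope_projection_eq[OF fin V, of h]
  show "\<Union>?T \<subseteq> P"
  proof (rule Union_least)
    fix S assume "S \<in> ?T"
    then obtain c y where "S = convex hull (tight V h c y)" unfolding T by blast
    then show "S \<subseteq> P" unfolding P(1) by (simp only: hull_mono[OF tight_subset])
  qed
  have finT: "finite ?T"
    by (rule finite_subset[of _ "(\<lambda>W. convex hull W) ` Pow V"]) (auto simp: T fin tight_subset)
  have "closed S" if S: "S \<in> ?T" for S
  proof -
    obtain c y where "S = convex hull (tight V h c y)" using S unfolding T by blast
    moreover have "finite (tight V h c y)" by (rule finite_subset[OF tight_subset fin])
    ultimately show ?thesis by (simp add: compact_imp_closed finite_imp_compact_convex_hull)
  qed
  then have closed: "closed (\<Union>?T)" by (intro closed_Union finT ballI)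
  \<comment> \<open>The lower-dimensional flats spanned by vertices: the points that
    \<open>lower_cell_exists\<close> does not reach.\<close>
  define N where "N = \<Union>((\<lambda>W. affine hull W) ` {W. W \<subseteq> V \<and> aff_dim W < int DIM('a)})"
  have N: "negligible N"
    unfolding N_def
  proof (intro negligible_Union)
    fix A assume "A \<in> (hull) affine ` {W. W \<subseteq> V \<and> aff_dim W < int DIM('a)}"
    then obtain W where W: "A = affine hull W" "aff_dim W < int DIM('a)" by blast
    then have "interior A = {}"
      using aff_dim_nonempty_interior[of A] by fastforce
    then show "negligible A"
      using W(1) by (simp add: negligible_convex_interior affine_imp_convex)
  qed (use fin in auto)
  have cover: "P - N \<subseteq> \<Union>?T"
  proof
    fix x assume x: "x \<in> P - N"
    have *: "aff_dim W = int DIM('a)" if "W \<subseteq> V" "x \<in> affine hull W" for W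
    proof -
      have "\<not> aff_dim W < int DIM('a)" using that x unfolding N_def by blast
      then show ?thesis using aff_dim_le_DIM[of W] by simp
    qed
    have "x \<in> convex hull V" using x P(1) by simp
    then obtain c y where
      "below V h c y" "aff_dim (tight V h c y) = int DIM('a)" "x \<in> convex hull (tight V h c y)"
      by (rule lower_cell_exists[OF fin _ *, where h = h])
    then show "x \<in> \<Union>?T" unfolding T by blast
  qed
  have "convex P" by (simp add: P(1))
  then show "P \<subseteq> \<Union>?T"
    by (intro closed_cover_generic[OF _ interior_nonempty_aff_dim closed N cover] P(2))
qed

text \<open>Affine independence of the tight sets makes the cells simplices. Two cells meet in the
  hull of their common vertices, and in a simplex every set of vertices spans a face.\<close>

lemma generic_lower_envelope_triangulation:
  fixes P :: "'a::euclidean_space set"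
  assumes fin: "finite V" and V: "V = polytope_vertices P" and P: "P = convex hull V" "aff_dim P = int DIM('a)"
    and gen: "generic_height V h"
  shows "is_triangulation_of (lower_envelope_projection P h) P"
proof -
  let ?T = "lower_envelope_projection P h"
  note T = lower_envelope_projection_eq[OF fin V, of h]
  have ind: "\<not> affine_dependent (tight V h c y)" for c y
    using gen by (simp add: generic_height_def)
  have finT: "finite ?T"
    by (rule finite_subset[of _ "(\<lambda>W. convex hull W) ` Pow V"]) (auto simp: T fin tight_subset)
  have simp: "int DIM('a) simplex S \<and> polytope_vertices S \<subseteq> V" if "S \<in> ?T" for S
  proof -
    obtain c y where S: "S = convex hull (tight V h c y)" "aff_dim (tight V h c y) = int DIM('a)"
      using \<open>S \<in> ?T\<close> unfolding T by blast
    have "int (card (tight V h c y)) = int DIM('a) + 1"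
      using S(2) aff_dim_affine_independent[OF ind[of c y]] by simp
    then show ?thesis
      using S(1) simplex_convex_hull[of "tight V h c y" "int DIM('a)"] ind[of c y] tight_subset[of V h c y]
      by (auto simp: polytope_vertices_def dest!: extreme_point_of_convex_hull)
  qed
  have face: "(S \<inter> S') face_of S" if "S \<in> ?T" "S' \<in> ?T" for S S'
  proof -
    obtain c y c' y' where S: "S = convex hull (tight V h c y)" "below V h c y"
      "S' = convex hull (tight V h c' y')" "below V h c' y'"
      using \<open>S \<in> ?T\<close> \<open>S' \<in> ?T\<close> unfolding T by blast
    show ?thesis
      unfolding S(1) face_of_convex_hull_affine_independent[OF ind]
      using tight_cells_Int[OF fin S(2,4)] S(1,3) by (metis Int_lower1)
  qed
  show ?thesis
    unfolding is_triangulation_of_def triangulation_def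
    using finT simp face lower_envelope_projection_covers[OF fin V P] V by (simp add: Int_commute) metis
qed

text \<open>An affine dependence annihilates every affine function. If a dependent set is tight, its
  dependence therefore annihilates the heights, which confines \<open>H\<close> to one of finitely
  many hyperplanes.\<close>

lemma negligible_nongeneric_heights:
  fixes V :: "'a::euclidean_space set" and e :: "'a \<Rightarrow> 'i::finite"
  assumes fin: "finite V" and inj: "inj_on e V"
  shows "negligible {H :: real ^ 'i. \<not> generic_height V (\<lambda>v. H $ e v)}"
proof -
  have "\<exists>\<mu>. sum \<mu> U = 0 \<and> (\<exists>v\<in>U. \<mu> v \<noteq> 0) \<and> (\<Sum>v\<in>U. \<mu> v *\<^sub>R v) = 0" if "U \<subseteq> V" "affine_dependent U" for U
    using that affine_dependent_explicit_finite[of U] finite_subset[OF _ fin] by auto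
  then obtain \<mu> where \<mu>: "\<And>U. U \<subseteq> V \<Longrightarrow> affine_dependent U \<Longrightarrow>
      sum (\<mu> U) U = 0 \<and> (\<exists>v\<in>U. \<mu> U v \<noteq> 0) \<and> (\<Sum>v\<in>U. \<mu> U v *\<^sub>R v) = 0"
    by metis
  \<comment> \<open>The normal vector of the hyperplane that belongs to \<open>U\<close>;
    injectivity of \<open>e\<close> keeps the coefficients in separate coordinates, so it is
    nonzero.\<close>
  define a :: "'a set \<Rightarrow> real ^ 'i" where "a U = (\<Sum>v\<in>U. \<mu> U v *\<^sub>R axis (e v) 1)" for U
  have a: "a U \<bullet> H = (\<Sum>v\<in>U. \<mu> U v * H $ e v)" for U H
    by (simp add: a_def inner_sum_left inner_axis')
  have "negligible (\<Union>((\<lambda>U. {H. a U \<bullet> H = 0}) ` {U. U \<subseteq> V \<and> affine_dependent U}))"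
  proof (intro negligible_Union)
    fix A assume "A \<in> (\<lambda>U. {H. a U \<bullet> H = 0}) ` {U. U \<subseteq> V \<and> affine_dependent U}"
    then obtain U where U: "A = {H. a U \<bullet> H = 0}" "U \<subseteq> V" "affine_dependent U" by blast
    then obtain v where v: "v \<in> U" "\<mu> U v \<noteq> 0" using \<mu> by blast
    have "a U $ e v = (\<Sum>w\<in>U. if w = v then \<mu> U v else 0)"
      unfolding a_def sum_component using v(1) inj U(2)
      by (intro sum.cong) (auto simp: axis_def inj_on_def)
    then have "a U $ e v = \<mu> U v"
      using v(1) finite_subset[OF U(2) fin] by simp
    then have "a U \<noteq> 0" using v(2) by auto
    then show "negligible A" unfolding U(1) by (intro negligible_hyperplane) auto
  qed (use fin in auto)
  moreover have "{H :: real ^ 'i. \<not> generic_height V (\<lambda>v. H $ e v)} \<subseteq> \<Union>((\<lambda>U. {H. a U \<bullet> H = 0}) ` {U. U \<subseteq> V \<and> affine_dependent U})"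
  proof
    fix H :: "real ^ 'i" assume "H \<in> {H. \<not> generic_height V (\<lambda>v. H $ e v)}"
    then obtain c y where dep: "affine_dependent (tight V (\<lambda>v. H $ e v) c y)"
      by (auto simp: generic_height_def)
    let ?U = "tight V (\<lambda>v. H $ e v) c y"
    have "a ?U \<bullet> H = (\<Sum>v\<in>?U. \<mu> ?U v * (c + y \<bullet> v))"
      unfolding a by (intro sum.cong) (auto simp: tight_def)
    also have "\<dots> = c * sum (\<mu> ?U) ?U + y \<bullet> (\<Sum>v\<in>?U. \<mu> ?U v *\<^sub>R v)"
      by (simp add: inner_sum_right sum.distrib sum_distrib_left algebra_simps)
    also have "\<dots> = 0"
      using \<mu>[OF tight_subset dep] by simp
    finally show "H \<in> \<Union>((\<lambda>U. {H. a U \<bullet> H = 0}) ` {U. U \<subseteq> V \<and> affine_dependent U})"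
      using dep tight_subset by blast
  qed
  ultimately show ?thesis by (rule negligible_subset)
qed

subsection \<open>Vertices of the secondary polytope\<close>

lemma simplex_polytope_vertices:
  assumes "n simplex S"
  shows "\<not> affine_dependent (polytope_vertices S)" "int (card (polytope_vertices S)) = n + 1"
    "convex hull (polytope_vertices S) = S"
proof -
  obtain C where C: "\<not> affine_dependent C" "int (card C) = n + 1" "S = convex hull C"
    using assms unfolding simplex_def by blast
  then have "polytope_vertices S = C"
    by (auto simp: polytope_vertices_def extreme_point_of_convex_hull_affine_independent)
  with C show "\<not> affine_dependent (polytope_vertices S)" "int (card (polytope_vertices S)) = n + 1"
    "convex hull (polytope_vertices S) = S" by auto
qed

lemma triangulation_cell:
  fixes T :: "'a::euclidean_space set set"
  assumes "is_triangulation_of T P" "S \<in> T"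
  shows "int DIM('a) simplex S" "polytope_vertices S \<subseteq> polytope_vertices P" "finite T" "\<Union>T = P"
  using assms by (auto simp: is_triangulation_of_def triangulation_def)

text \<open>Two different cells meet in a proper face of at least one of them, hence in a negligible
  set.\<close>

lemma has_integral_triangulation:
  fixes T :: "'a::euclidean_space set set" and f :: "'a \<Rightarrow> real"
  assumes T: "is_triangulation_of T P" and i: "\<And>S. S \<in> T \<Longrightarrow> (f has_integral i S) S"
  shows "(f has_integral sum i T) P"
proof -
  have "negligible (S \<inter> S')" if S: "S \<in> T" "S' \<in> T" "S \<noteq> S'" for S S'
  proof -
    have face: "(S \<inter> S') face_of S" "(S \<inter> S') face_of S'"
      using T S unfolding is_triangulation_of_def triangulation_def by (metis Int_commute)+
    have dim: "aff_dim S = int DIM('a)" "aff_dim S' = int DIM('a)" "convex S" "convex S'"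
      using triangulation_cell(1)[OF T] S aff_dim_simplex convex_simplex by blast+
    have "S \<inter> S' \<noteq> S \<or> S \<inter> S' \<noteq> S'" using S(3) by auto
    then have "aff_dim (S \<inter> S') < int DIM('a)"
      using face_of_aff_dim_lt[OF dim(3) face(1)] face_of_aff_dim_lt[OF dim(4) face(2)] dim by auto
    then have "interior (S \<inter> S') = {}"
      using aff_dim_nonempty_interior[of "S \<inter> S'"] by fastforce
    then show ?thesis
      using negligible_convex_interior[OF convex_Int[OF dim(3,4)]] by simp
  qed
  then have pw: "pairwise (\<lambda>S S'. negligible (S \<inter> S')) T"
    by (simp add: pairwise_def)
  have "finite T" "\<Union>T = P"
    using T by (auto simp: is_triangulation_of_def triangulation_def)
  moreover from this(1) have "(f has_integral sum i T) (\<Union>T)"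
    using i pw by (rule has_integral_Union)
  ultimately show ?thesis by simp
qed

lemma continuous_on_Max_image:
  fixes f :: "'i \<Rightarrow> 'a::topological_space \<Rightarrow> real"
  assumes "finite I" "I \<noteq> {}" "\<And>i. i \<in> I \<Longrightarrow> continuous_on A (f i)"
  shows "continuous_on A (\<lambda>x. Max ((\<lambda>i. f i x) ` I))"
  using assms by (induction I rule: finite_ne_induct) (auto intro!: continuous_on_max)

text \<open>The maximum of the affine functions carried by the cells of the lower envelope agrees with
  each of them on its cell, and lies below the interpolation of h on every other triangulation.\<close>

lemma lower_envelope_minimizes:
  fixes P :: "(real ^ 'n::finite) set"
  assumes fin: "finite V" and V: "V = polytope_vertices P" and P: "P = convex hull V" "aff_dim P = int DIM(real ^ 'n)"
    and gen: "generic_height V h" and T': "is_triangulation_of T' P"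
  shows "(\<Sum>S\<in>lower_envelope_projection P h. measure lborel S * (\<Sum>v\<in>polytope_vertices S. h v))
    \<le> (\<Sum>S\<in>T'. measure lborel S * (\<Sum>v\<in>polytope_vertices S. h v))"
proof -
  define T where "T = lower_envelope_projection P h"
  note Teq = lower_envelope_projection_eq[OF fin V, of h, folded T_def]
  have T: "is_triangulation_of T P"
    unfolding T_def by (rule generic_lower_envelope_triangulation[OF fin V P gen])
  have finT: "finite T" "\<Union>T = P"
    using T by (auto simp: is_triangulation_of_def triangulation_def)
  have "T \<noteq> {}" using finT(2) P(2) by auto
  have "\<exists>c y. S = convex hull (tight V h c y) \<and> below V h c y" if "S \<in> T" for S
    using that unfolding Teq by blast
  then obtain c y where cy: "\<And>S. S \<in> T \<Longrightarrow> S = convex hull (tight V h (c S) (y S)) \<and> below V h (c S) (y S)"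
    by metis
  define f where "f x = Max ((\<lambda>S. c S + y S \<bullet> x) ` T)" for x
  have cont: "continuous_on A f" for A
    unfolding f_def using \<open>T \<noteq> {}\<close> finT(1) by (intro continuous_on_Max_image continuous_intros)
  have ge: "c S + y S \<bullet> x \<le> f x" if "S \<in> T" for S x
    unfolding f_def using finT(1) that by (intro Max_ge) auto
  have le: "f x \<le> r + z \<bullet> x" if W: "x \<in> convex hull W" "W \<subseteq> V" "\<And>w. w \<in> W \<Longrightarrow> r + z \<bullet> w = h w" for x r z W
  proof -
    have "c S + y S \<bullet> x \<le> r + z \<bullet> x" if "S \<in> T" for S
      using W cy[OF that] by (intro affine_fun_le_convex_hull[OF W(1)]) (auto simp: below_def)
    then show ?thesis
      unfolding f_def using finT(1) \<open>T \<noteq> {}\<close> by (subst Max_le_iff) auto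
  qed
  \<comment> \<open>All cells have the same number of vertices, so averaging over them costs one
    common factor, cleared at the end.\<close>
  let ?d = "real (DIM(real ^ 'n) + 1)"
  let ?I = "\<lambda>S. measure lborel S / ?d * (\<Sum>v\<in>polytope_vertices S. h v)"
  have affint: "((\<lambda>x. r + z \<bullet> x) has_integral ?I S) S"
    if S: "int DIM(real ^ 'n) simplex S" "\<And>v. v \<in> polytope_vertices S \<Longrightarrow> r + z \<bullet> v = h v" for S r z
  proof -
    note pv = simplex_polytope_vertices[OF S(1)]
    have "real (card (polytope_vertices S)) = ?d"
      using pv(2) by linarith
    with has_integral_affine_simplex[OF pv(1), of r z] show ?thesis
      using S(2) by (simp add: pv(3))
  qed
  have "(f has_integral (\<Sum>S\<in>T. ?I S)) P"
  proof (rule has_integral_triangulation[OF T])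
    fix S assume S: "S \<in> T"
    have tight: "polytope_vertices S \<subseteq> tight V h (c S) (y S)"
      using cy[OF S] extreme_points_of_convex_hull by (metis polytope_vertices_def)
    have "f x = c S + y S \<bullet> x" if "x \<in> S" for x
      using that cy[OF S] tight_subset
      by (intro antisym ge[OF S] le[of x "tight V h (c S) (y S)"]) (auto simp: tight_def)
    moreover have "((\<lambda>x. c S + y S \<bullet> x) has_integral ?I S) S"
      using tight triangulation_cell(1)[OF T S] by (intro affint) (auto simp: tight_def)
    ultimately show "(f has_integral ?I S) S"
      by (metis (no_types, lifting) has_integral_eq)
  qed
  moreover have "(f has_integral (\<Sum>S\<in>T'. integral S f)) P"
  proof (rule has_integral_triangulation[OF T'])
    fix S assume S: "S \<in> T'"
    have "compact S" using triangulation_cell(1)[OF T' S] by (rule compact_simplex)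
    then show "(f has_integral integral S f) S"
      by (intro integrable_integral integrable_on_compact cont)
  qed
  ultimately have eq: "(\<Sum>S\<in>T. ?I S) = (\<Sum>S\<in>T'. integral S f)"
    by (rule has_integral_unique)
  have "integral S f \<le> ?I S" if S: "S \<in> T'" for S
  proof -
    note simp = triangulation_cell(1)[OF T' S]
    obtain r z where rz: "\<And>v. v \<in> polytope_vertices S \<Longrightarrow> r + z \<bullet> v = h v"
      using affine_interpolation[OF simplex_polytope_vertices(1)[OF simp]] by metis
    have "(f has_integral integral S f) S"
      by (intro integrable_integral integrable_on_compact cont compact_simplex[OF simp])
    moreover have "f x \<le> r + z \<bullet> x" if "x \<in> S" for x
      using that rz triangulation_cell(2)[OF T' S] V simplex_polytope_vertices(3)[OF simp]
      by (intro le[of x "polytope_vertices S"]) auto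
    ultimately show ?thesis
      using affint[OF simp rz] has_integral_le by blast
  qed
  then have "(\<Sum>S\<in>T. ?I S) \<le> (\<Sum>S\<in>T'. ?I S)"
    unfolding eq by (rule sum_mono)
  then have "(\<Sum>S\<in>T. ?d * ?I S) \<le> (\<Sum>S\<in>T'. ?d * ?I S)"
    by (simp only: flip: sum_distrib_left) (simp add: mult_left_mono)
  then show ?thesis by (simp add: T_def)
qed

section \<open>GKZ vectors as linear functionals of the heights\<close>

definition support :: "real ^ 'n \<Rightarrow> 'n set" where
  "support v = {i. v $ i = 1}"

lemma support_indicator_vec [simp]: "support (indicator_vec F) = F"
  by (auto simp: support_def indicator_vec_def)

text \<open>A vertex of the cube is exposed: up to a constant, the functional \<open>d\<close>
  counts the coordinates in which a 0/1 vector differs from \<open>indicator_vec F\<close>, so its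
  minimum is attained only there.\<close>

lemma indicator_vec_in_hull:
  fixes F :: "'n::finite set"
  assumes W: "W \<subseteq> range indicator_vec" and F: "indicator_vec F \<in> convex hull W"
  shows "indicator_vec F \<in> W"
proof -
  define d :: "real ^ 'n" where "d = (\<chi> i. if i \<in> F then -1 else 1)"
  have "finite W" using W by (rule finite_subset) simp
  have diff: "d \<bullet> indicator_vec G - d \<bullet> indicator_vec F = (\<Sum>i\<in>UNIV. if i \<in> F \<longleftrightarrow> i \<in> G then 0 else 1)" for G
    unfolding inner_vec_def sum_subtractf[symmetric]
    by (intro sum.cong) (auto simp: d_def indicator_vec_def)
  have "d \<bullet> indicator_vec F \<le> d \<bullet> w" if w: "w \<in> W" for w
  proof -
    obtain G where "w = indicator_vec G" using W w by blast
    then show ?thesis using diff[of G] by (smt (verit) sum_nonneg)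
  qed
  then have "indicator_vec F \<in> convex hull {w \<in> W. d \<bullet> w = d \<bullet> indicator_vec F}"
    by (intro convex_hull_supporting \<open>finite W\<close> F) auto
  then obtain w where w: "w \<in> W" "d \<bullet> w = d \<bullet> indicator_vec F"
    by (metis (mono_tags, lifting) Collect_empty_eq convex_hull_empty empty_iff)
  obtain G where G: "w = indicator_vec G" using W w(1) by blast
  have "\<forall>i\<in>UNIV. (if i \<in> F \<longleftrightarrow> i \<in> G then 0 else 1 :: real) = 0"
    using diff[of G] w(2) unfolding G by (subst (asm) eq_commute) (simp add: sum_nonneg_eq_0_iff)
  then have "F = G" by (auto split: if_splits)
  then show ?thesis using w G by simp
qed

text \<open>Double counting of pairs of a cell and a vertex in it.
  \<open>indicator_vec_in_hull\<close> ensures that the indicator vectors contained in a cell are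
  exactly its vertices.\<close>

lemma inner_gkz_vector:
  fixes P :: "(real ^ 'n::finite) set"
  assumes T: "is_triangulation_of T P" and P: "polytope_vertices P \<subseteq> range indicator_vec"
  shows "H \<bullet> gkz_vector T = (\<Sum>S\<in>T. measure lborel S * (\<Sum>v\<in>polytope_vertices S. H $ support v))"
proof -
  have finT: "finite T" using T by (auto simp: is_triangulation_of_def triangulation_def)
  have "H \<bullet> gkz_vector T = (\<Sum>F\<in>UNIV. \<Sum>S\<in>T. if indicator_vec F \<in> S then measure lborel S * H $ F else 0)"
    unfolding inner_vec_def gkz_vector_def
    by (intro sum.cong)
      (auto simp: sum_distrib_left mult.commute sum.inter_filter[OF finT] if_distrib intro!: sum.cong)
  also have "\<dots> = (\<Sum>S\<in>T. \<Sum>F\<in>UNIV. if indicator_vec F \<in> S then measure lborel S * H $ F else 0)"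
    by (rule sum.swap)
  also have "\<dots> = (\<Sum>S\<in>T. measure lborel S * (\<Sum>v\<in>polytope_vertices S. H $ support v))"
  proof (rule sum.cong[OF refl])
    fix S assume S: "S \<in> T"
    note hull = simplex_polytope_vertices(3)[OF triangulation_cell(1)[OF T S]]
    have sub: "polytope_vertices S \<subseteq> range indicator_vec"
      using triangulation_cell(2)[OF T S] P by blast
    have "bij_betw support (polytope_vertices S) {F. indicator_vec F \<in> S}"
    proof (rule bij_betw_byWitness[where f' = indicator_vec])
      show "\<forall>v\<in>polytope_vertices S. indicator_vec (support v) = v" using sub by fastforce
      then show "support ` polytope_vertices S \<subseteq> {F. indicator_vec F \<in> S}"
        using hull hull_subset[of "polytope_vertices S" convex] by auto
      show "indicator_vec ` {F. indicator_vec F \<in> S} \<subseteq> polytope_vertices S"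
        using indicator_vec_in_hull[OF sub] hull by auto
    qed simp
    then have "(\<Sum>v\<in>polytope_vertices S. H $ support v) = (\<Sum>F | indicator_vec F \<in> S. H $ F)"
      by (rule sum.reindex_bij_betw)
    then show "(\<Sum>F\<in>UNIV. if indicator_vec F \<in> S then measure lborel S * H $ F else 0)
        = measure lborel S * (\<Sum>v\<in>polytope_vertices S. H $ support v)"
      by (simp add: sum_distrib_left sum.If_cases)
  qed
  finally show ?thesis .
qed

text \<open>Removing an extreme point leaves a convex set, so \<open>z\<close> lies outside the
  compact hull of the other points and can be strictly separated from it.\<close>

lemma extreme_point_separated:
  fixes z :: "'a::euclidean_space"
  assumes fin: "finite X" and z: "z extreme_point_of (convex hull X)"
  obtains a where "\<And>x. x \<in> X - {z} \<Longrightarrow> a \<bullet> z < a \<bullet> x"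
proof -
  have "convex (convex hull X - {z})"
    using z extreme_point_of_stillconvex[of "convex hull X" z] by simp
  then have "convex hull (X - {z}) \<subseteq> convex hull X - {z}"
    by (intro hull_minimal) (auto intro: hull_inc)
  then have "z \<notin> convex hull (X - {z})" by blast
  moreover have "closed (convex hull (X - {z}))"
    using fin by (simp add: compact_imp_closed finite_imp_compact_convex_hull)
  ultimately obtain a b where "a \<bullet> z < b" "\<forall>x\<in>convex hull (X - {z}). a \<bullet> x > b"
    using separating_hyperplane_closed_point[of "convex hull (X - {z})" z] by auto
  then show ?thesis by (intro that[of a]) (meson hull_inc less_trans)
qed

theorem secondary_polytope_vertex_regular:
  fixes P :: "(real ^ 'n::finite) set"
  assumes P: "compact P" "convex P" "P \<noteq> {}" and V01: "polytope_vertices P \<subseteq> range indicator_vec"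
    and z: "z extreme_point_of secondary_polytope P"
  obtains T where "is_regular_triangulation_of T P" "gkz_vector T = z"
proof -
  define V where "V = polytope_vertices P"
  have finV: "finite V" using V01 unfolding V_def by (rule finite_subset) simp
  have PV: "P = convex hull V"
    using Krein_Milman_Minkowski[OF P(1,2)] by (simp add: V_def polytope_vertices_def)
  define X where "X = {gkz_vector T | T. is_triangulation_of T P}"
  \<comment> \<open>Every cell is the hull of a subset of \<open>V\<close>, so there are only
    finitely many triangulations.\<close>
  have "T \<subseteq> (\<lambda>W. convex hull W) ` Pow V" if "is_triangulation_of T P" for T
    using triangulation_cell(1,2)[OF that] simplex_polytope_vertices(3) unfolding V_def by (fastforce simp: image_iff)
  then have "{T. is_triangulation_of T P} \<subseteq> Pow ((\<lambda>W. convex hull W) ` Pow V)" by blast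
  then have "finite {T. is_triangulation_of T P}"
    by (rule finite_subset) (simp add: finV)
  then have finX: "finite X" unfolding X_def by (simp add: setcompr_eq_image)
  have zX: "z \<in> X"
    using z extreme_point_of_convex_hull unfolding secondary_polytope_def X_def by blast
  then obtain T\<^sub>0 where T\<^sub>0: "is_triangulation_of T\<^sub>0 P" "z = gkz_vector T\<^sub>0"
    unfolding X_def by blast
  have full: "aff_dim P = int DIM(real ^ 'n)"
  proof -
    obtain S where "S \<in> T\<^sub>0" using T\<^sub>0(1) P(3) by (auto simp: is_triangulation_of_def)
    then have "aff_dim S = int DIM(real ^ 'n)" "S \<subseteq> P"
      using triangulation_cell[OF T\<^sub>0(1)] aff_dim_simplex by blast+
    then show ?thesis using aff_dim_subset[of S P] aff_dim_le_DIM[of P] by linarith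
  qed
  obtain a where a: "\<And>x. x \<in> X - {z} \<Longrightarrow> a \<bullet> z < a \<bullet> x"
    using extreme_point_separated[OF finX, of z] z unfolding secondary_polytope_def X_def by blast
  \<comment> \<open>The functionals with \<open>z\<close> as unique minimizer form an open set;
    being nonempty it is not negligible, so it contains a generic one.\<close>
  define O' where "O' = (\<Inter>x\<in>X - {z}. {H. H \<bullet> z < H \<bullet> x})"
  have "open O'"
    unfolding O'_def using finX by (intro open_INT ballI open_Collect_less continuous_intros) auto
  moreover have "a \<in> O'" using a by (auto simp: O'_def)
  ultimately have "\<not> negligible O'" using open_not_negligible by blast
  moreover have "inj_on support V"
    using V01 unfolding V_def by (intro inj_on_inverseI[where g = indicator_vec]) auto
  then have "negligible {H :: real ^ 'n set. \<not> generic_height V (\<lambda>v. H $ support v)}"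
    by (rule negligible_nongeneric_heights[OF finV])
  ultimately obtain H where H: "H \<in> O'" "generic_height V (\<lambda>v. H $ support v)"
    using negligible_subset by blast
  define T where "T = lower_envelope_projection P (\<lambda>v. H $ support v)"
  have T: "is_triangulation_of T P"
    unfolding T_def by (rule generic_lower_envelope_triangulation[OF finV V_def PV full H(2)])
  have "H \<bullet> gkz_vector T \<le> H \<bullet> z"
    using lower_envelope_minimizes[OF finV V_def PV full H(2) T\<^sub>0(1)]
    by (simp add: inner_gkz_vector[OF T V01] inner_gkz_vector[OF T\<^sub>0(1) V01] T\<^sub>0(2) flip: T_def)
  moreover have "gkz_vector T \<in> X" using T by (auto simp: X_def)
  moreover have "H \<bullet> z < H \<bullet> x" if "x \<in> X" "x \<noteq> z" for x
    using H(1) that by (auto simp: O'_def)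
  ultimately have "gkz_vector T = z" by fastforce
  then show ?thesis
    using T that unfolding is_regular_triangulation_of_def T_def by blast
qed

subsection \<open>Unimodularity of order polytopes\<close>

text \<open>Applied to the barycentric coordinates of a cell, \<open>int\<close> yields integral
  affine functions with the same values at its vertices; their gradients are the dual vectors for
  \<open>measure_unimodular_simplex\<close>.\<close>

lemma unimodular_triangulation:
  fixes P :: "(real ^ 'n::finite) set"
  assumes T: "is_triangulation_of T P" and V01: "polytope_vertices P \<subseteq> range indicator_vec"
    and int: "\<And>c y v. v \<in> polytope_vertices P \<Longrightarrow> c + y \<bullet> v = 1 \<Longrightarrow>
      \<exists>c' y'. (\<forall>i. y' $ i \<in> \<int>) \<and> c' + y' \<bullet> v = 1 \<and>
        (\<forall>u\<in>polytope_vertices P. c + y \<bullet> u = 0 \<longrightarrow> c' + y' \<bullet> u = 0)"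
  shows "unimodular T"
  unfolding unimodular_def
proof
  fix S assume S: "S \<in> T"
  define C where "C = polytope_vertices S"
  note cell = triangulation_cell[OF T S]
  note C = simplex_polytope_vertices[OF cell(1), folded C_def]
  have CV: "C \<subseteq> polytope_vertices P" using cell(2) by (simp add: C_def)
  have card: "card C = Suc CARD('n)" using C(2) by simp
  then have finC: "finite C" by (metis card.infinite nat.distinct(1))
  have "\<exists>c' y'. (\<forall>i. y' $ i \<in> \<int>) \<and> c' + y' \<bullet> v = 1 \<and> (\<forall>u\<in>C - {v}. c' + y' \<bullet> u = 0)" if v: "v \<in> C" for v
  proof -
    obtain c y where cy: "\<And>u. u \<in> C \<Longrightarrow> c + y \<bullet> u = (if u = v then 1 else 0)"
      using affine_interpolation[OF C(1), of "\<lambda>u. if u = v then 1 else 0"] by blast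
    then show ?thesis
      using int[of v c y] v CV by (metis DiffD1 DiffD2 insertI1 subsetD)
  qed
  then obtain c' y' where y': "\<And>v i. v \<in> C \<Longrightarrow> y' v $ i \<in> \<int>" "\<And>v. v \<in> C \<Longrightarrow> c' v + y' v \<bullet> v = 1"
    "\<And>u v. v \<in> C \<Longrightarrow> u \<in> C - {v} \<Longrightarrow> c' v + y' v \<bullet> u = 0"
    by metis
  obtain x0 where x0: "x0 \<in> C" using card by fastforce
  have "card (C - {x0}) = CARD('n)" using card x0 finC by simp
  then obtain f :: "'n \<Rightarrow> real ^ 'n" where f: "bij_betw f UNIV (C - {x0})"
    using finite_same_card_bij[of "UNIV :: 'n set" "C - {x0}"] finC by auto
  have fC: "f i \<in> C" "f i \<noteq> x0" for i using f by (auto simp: bij_betw_def)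
  have "measure lborel (convex hull C) = 1 / fact CARD('n)"
  proof (rule measure_unimodular_simplex[OF finC card x0 f, where Y = "\<chi> i. y' (f i)"])
    fix v i assume "v \<in> C"
    then have "v \<in> range indicator_vec" using CV V01 by blast
    then show "v $ i \<in> \<int>" by (auto simp: indicator_vec_def)
  next
    fix i j
    have "f i = f j \<longleftrightarrow> i = j" using f by (auto simp: bij_betw_def inj_on_def)
    then show "(\<chi> i. y' (f i)) $ i \<bullet> (f j - x0) = (if i = j then 1 else 0)"
      using y'(2)[OF fC(1)[of i]] y'(3)[OF fC(1)[of i], of "f j"] y'(3)[OF fC(1)[of i], of x0] fC[of i] fC(1)[of j] x0
      by (auto simp: inner_diff_right)
  qed (use y'(1) fC in auto)
  then show "normalized_volume S = 1"
    by (simp add: C(3) normalized_volume_def)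
qed

section \<open>Potentials on the indices\<close>

fun turn_sign :: "(nat \<Rightarrow> nat) \<Rightarrow> nat \<Rightarrow> real" where
  "turn_sign a 0 = 1"
| "turn_sign a (Suc k) = (if k \<ge> 1 \<and> a (Suc k) = k then - turn_sign a k else turn_sign a k)"

text \<open>Solves \<open>s k = turn_sign a k * (p k - p (a k))\<close> for \<open>p\<close> along
  the tree with edges from \<open>k\<close> to \<open>a k\<close>, with root 0. For the sequences
  considered later the guard holds at every positive \<open>k\<close>; \<open>turn_sign\<close>
  flips whenever \<open>a\<close> moves.\<close>

function potential :: "(nat \<Rightarrow> nat) \<Rightarrow> (nat \<Rightarrow> real) \<Rightarrow> nat \<Rightarrow> real" where
  "potential a s k = (if a k < k then turn_sign a k * s k + potential a s (a k) else 0)"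
  by auto
termination by (relation "Wellfounded.measure (\<lambda>(a, s, k). k)") auto

declare potential.simps [simp del]

lemma turn_sign_square: "turn_sign a k * turn_sign a k = 1"
  by (induction k) auto

text \<open>The elements of the poset are indexed by 0, 1, 2, ..., and a nonempty filter is either the
  set of all indices below k (b = False) or this set without the index a k - 1 (b = True).
  Given the values s k of an affine function on the former filters, filter_value yields its
  value on all of them.\<close>

definition filter_value :: "(nat \<Rightarrow> nat) \<Rightarrow> (nat \<Rightarrow> real) \<Rightarrow> nat \<Rightarrow> bool \<Rightarrow> real" where
  "filter_value a s k b = (if b then s k - s (a k) + s (a k - 1) else s k)"

text \<open>The second endpoint of the edge of a filter, the first being \<open>k\<close>. With an
  index removed, the edges of \<open>s k\<close>, \<open>s (a k)\<close> and
  \<open>s (a k - 1)\<close> cancel to one edge.\<close>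

definition filter_tail :: "(nat \<Rightarrow> nat) \<Rightarrow> nat \<Rightarrow> bool \<Rightarrow> nat" where
  "filter_tail a k b = (if b then (if a (a k) = a (a k - 1) then a k - 1 else a (a k - 1)) else a k)"

text \<open>When \<open>a\<close> moves to \<open>k\<close>, the sign flips between \<open>k\<close>
  and \<open>Suc k\<close>; until the next move both stay constant. So \<open>k\<close> and
  \<open>a k\<close> have opposite signs.\<close>

lemma turn_index:
  fixes a :: "nat \<Rightarrow> nat"
  assumes a1: "a 1 = 0" and step: "\<And>k. k \<ge> 1 \<Longrightarrow> a (Suc k) = a k \<or> a (Suc k) = k" and k: "k \<ge> 1"
  shows "a k < k" "a k \<ge> 1 \<Longrightarrow> turn_sign a (a k) = - turn_sign a k"
proof -
  have "a k < k \<and> (a k \<ge> 1 \<longrightarrow> turn_sign a (a k) = - turn_sign a k)"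
    using k
  proof (induction k rule: dec_induct)
    case (step k)
    then show ?case using assms(2)[of k] by auto
  qed (use a1 in auto)
  then show "a k < k" "a k \<ge> 1 \<Longrightarrow> turn_sign a (a k) = - turn_sign a k" by auto
qed

text \<open>Up to sign, every filter is an edge of a graph on the indices: affine functions become
  differences of potentials.\<close>

lemma filter_value_potential:
  fixes a :: "nat \<Rightarrow> nat"
  assumes a1: "a 1 = 0" and step: "\<And>k. k \<ge> 1 \<Longrightarrow> a (Suc k) = a k \<or> a (Suc k) = k"
    and s: "\<And>k. k \<ge> 1 \<Longrightarrow> s k = turn_sign a k * (p k - p (a k))"
    and k: "k \<ge> 1" "b \<Longrightarrow> a k \<ge> 2"
  shows "filter_value a s k b = turn_sign a k * (p k - p (filter_tail a k b))"
proof (cases b)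
  case True
  obtain j where j: "a k = Suc j" "j \<ge> 1" using k True by (cases "a k") auto
  note lt = turn_index(1)[OF a1 step]
  have sgn: "turn_sign a (Suc j) = - turn_sign a k"
    using turn_index(2)[OF a1 step k(1)] j by simp
  have val: "filter_value a s k b = s k - s (Suc j) + s j"
    using True j by (simp add: filter_value_def)
  \<comment> \<open>If \<open>a\<close> does not move at \<open>j\<close>, the edges of
    \<open>Suc j\<close> and \<open>j\<close> share their lower end, which cancels, leaving
    \<open>j\<close>. If it moves, the edges form a path from \<open>k\<close> through
    \<open>Suc j\<close> and \<open>j\<close> to \<open>a j\<close>.\<close>
  consider "a (Suc j) = a j" "a j < j" | "a (Suc j) = j" "a (Suc j) \<noteq> a j"
    using step[of j] lt[of j] j(2) by auto
  then show ?thesis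
  proof cases
    case 1
    then have "turn_sign a j = - turn_sign a k" using sgn by simp
    then show ?thesis
      using 1 sgn True j k unfolding val filter_tail_def
      by (simp add: s[of k] s[of "Suc j"] s[of j]) (simp add: algebra_simps)
  next
    case 2
    then have "turn_sign a j = turn_sign a k" using sgn j(2) by simp
    then show ?thesis
      using 2 sgn True j k unfolding val filter_tail_def
      by (simp add: s[of k] s[of "Suc j"] s[of j]) (simp add: algebra_simps)
  qed
qed (simp add: filter_value_def filter_tail_def s[OF k(1)])

text \<open>Replacing the potential by the indicator function of one of its level sets keeps all
  zero differences.\<close>

lemma integral_filter_value:
  fixes a :: "nat \<Rightarrow> nat"
  assumes a1: "a 1 = 0" and step: "\<And>k. k \<ge> 1 \<Longrightarrow> a (Suc k) = a k \<or> a (Suc k) = k"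
    and k0: "k0 \<ge> 1" "b0 \<Longrightarrow> a k0 \<ge> 2" "filter_value a s k0 b0 \<noteq> 0"
  obtains s' where "s' 0 = 0" "\<And>k. s' k \<in> \<int>" "filter_value a s' k0 b0 = 1"
    "\<And>k b. k \<ge> 1 \<Longrightarrow> (b \<Longrightarrow> a k \<ge> 2) \<Longrightarrow> filter_value a s k b = 0 \<Longrightarrow> filter_value a s' k b = 0"
proof -
  define p where "p = potential a s"
  have s: "s k = turn_sign a k * (p k - p (a k))" if "k \<ge> 1" for k
  proof -
    have "p k = turn_sign a k * s k + p (a k)"
      using turn_index(1)[OF a1 step that] potential.simps[of a s k] by (simp add: p_def)
    then show ?thesis
      using turn_sign_square[of a k] by (simp flip: mult.assoc)
  qed
  have int: "turn_sign a k \<in> \<int>" for k by (induction k) auto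
  \<comment> \<open>The level set is that of \<open>p k0\<close>. The other end of the edge of
    \<open>(k0, b0)\<close> is outside it because the value there is nonzero, and the height
    \<open>turn_sign a k0\<close> makes the new value a squared sign, that is 1.\<close>
  define p' where "p' k = (if p k = p k0 then turn_sign a k0 else 0)" for k
  \<comment> \<open>The value at 0 belongs to the empty filter and is not given by an edge, so it is
    set separately.\<close>
  define s' where "s' k = (if k = 0 then 0 else turn_sign a k * (p' k - p' (a k)))" for k
  have val: "filter_value a s k b = turn_sign a k * (p k - p (filter_tail a k b))"
    if "k \<ge> 1" "b \<Longrightarrow> a k \<ge> 2" for k b
    by (rule filter_value_potential[OF a1 step s that])
  have val': "filter_value a s' k b = turn_sign a k * (p' k - p' (filter_tail a k b))"
    if "k \<ge> 1" "b \<Longrightarrow> a k \<ge> 2" for k b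
    by (rule filter_value_potential[OF a1 step _ that]) (auto simp: s'_def)
  show ?thesis
  proof (rule that[of s'])
    show "s' k \<in> \<int>" for k
      using int by (auto simp: s'_def p'_def intro!: Ints_mult Ints_diff)
    show "filter_value a s' k0 b0 = 1"
      using k0 val[OF k0(1,2)] turn_sign_square[of a k0] by (auto simp: val' p'_def)
    show "filter_value a s' k b = 0" if "k \<ge> 1" "b \<Longrightarrow> a k \<ge> 2" "filter_value a s k b = 0" for k b
    proof -
      have "turn_sign a k \<noteq> 0" using turn_sign_square[of a k] by auto
      then have "p k = p (filter_tail a k b)" using val[OF that(1,2)] that(3) by simp
      then show ?thesis using val'[OF that(1,2)] by (simp add: p'_def)
    qed
  qed (simp add: s'_def)
qed

section \<open>Vertices of order polytopes and codes of filters\<close>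

lemma compact_order_polytope: "compact (order_polytope lt)"
proof -
  have "closed (order_polytope lt)"
    unfolding order_polytope_def
    by (intro closed_Collect_conj closed_Collect_all closed_Collect_imp closed_Collect_le open_Collect_const continuous_intros)
  moreover have "order_polytope lt \<subseteq> cbox 0 1"
    by (auto simp: order_polytope_def mem_box_cart)
  ultimately show ?thesis
    by (meson bounded_cbox bounded_subset compact_eq_bounded_closed)
qed

lemma convex_order_polytope: "convex (order_polytope lt)"
  unfolding order_polytope_def
  by (auto intro!: convexI add_mono mult_left_mono convex_bound_le)

text \<open>A vertex x is the midpoint of the two points with coordinates x_i^2 and 2 x_i - x_i^2,
  and both of these lie in the polytope because r^2 and 2 r - r^2 are monotone on [0,1].\<close>

lemma order_polytope_vertex:
  fixes lt :: "'n::finite \<Rightarrow> 'n \<Rightarrow> bool"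
  assumes x: "x \<in> polytope_vertices (order_polytope lt)"
  obtains F where "x = indicator_vec F" "\<And>i j. i \<in> F \<Longrightarrow> lt i j \<Longrightarrow> j \<in> F"
proof -
  define u v :: "real ^ 'n" where "u = (\<chi> i. x $ i * x $ i)" and "v = (\<chi> i. 2 * x $ i - x $ i * x $ i)"
  have ext: "x extreme_point_of order_polytope lt"
    using x by (simp add: polytope_vertices_def)
  then have mem: "0 \<le> x $ i" "x $ i \<le> 1" "lt i j \<Longrightarrow> x $ i \<le> x $ j" for i j
    by (auto simp: extreme_point_of_def order_polytope_def)
  have sq: "r * r \<le> t * t" "2 * r - r * r \<le> 2 * t - t * t" if "0 \<le> r" "r \<le> t" "t \<le> 1" for r t :: real
  proof -
    show "r * r \<le> t * t" using that by (intro mult_mono) auto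
    have "0 \<le> (t - r) * (2 - t - r)" using that by (intro mult_nonneg_nonneg) auto
    then show "2 * r - r * r \<le> 2 * t - t * t" by (simp add: algebra_simps)
  qed
  have "u \<in> order_polytope lt"
    using mem sq(1)[of "x $ i" 1 for i] sq(1) by (auto simp: order_polytope_def u_def)
  moreover have "v \<in> order_polytope lt"
    using mem sq(2)[of 0 "x $ i" for i] sq(2)[of "x $ i" 1 for i] sq(2) by (auto simp: order_polytope_def v_def)
  moreover have "x = midpoint u v"
    by (simp add: midpoint_def u_def v_def vec_eq_iff)
  ultimately have "u = v"
    using ext midpoint_in_open_segment[of u v] unfolding extreme_point_of_def by blast
  then have "x $ i * x $ i = x $ i" for i
    by (auto simp: u_def v_def vec_eq_iff)
  then have "x $ i = 0 \<or> x $ i = 1" for i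
    by (metis mult_cancel_left1)
  then have "x = indicator_vec {i. x $ i = 1}"
    by (auto simp: indicator_vec_def vec_eq_iff)
  moreover have "j \<in> {i. x $ i = 1}" if "i \<in> {i. x $ i = 1}" "lt i j" for i j
    using that mem(3)[of i j] mem(2)[of j] by auto
  ultimately show ?thesis by (rule that)
qed

lemma inner_indicator_vec: "y \<bullet> indicator_vec F = (\<Sum>i\<in>F. y $ i)"
  by (simp add: inner_vec_def indicator_vec_def if_distrib sum.If_cases cong: if_cong)

text \<open>By \<open>lt\<close>, each element lies below all elements of smaller index with at most
  one exception, located by \<open>a\<close>. A nonempty filter is thus determined by its largest
  index and by whether it omits that exception.\<close>

lemma unimodular_order_polytope:
  fixes lt :: "'n::finite \<Rightarrow> 'n \<Rightarrow> bool" and ix :: "'n \<Rightarrow> nat" and a :: "nat \<Rightarrow> nat"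
  assumes ix: "bij_betw ix UNIV {..<N}"
    and a1: "a 1 = 0" and step: "\<And>k. k \<ge> 1 \<Longrightarrow> a (Suc k) = a k \<or> a (Suc k) = k"
    and lt: "\<And>i j. ix j < ix i \<Longrightarrow> \<not> (a (Suc (ix i)) \<ge> 2 \<and> ix j = a (Suc (ix i)) - 1) \<Longrightarrow> lt i j"
    and T: "is_triangulation_of T (order_polytope lt)"
  shows "unimodular T"
proof -
  let ?V = "polytope_vertices (order_polytope lt)"
  define I where "I k = {i. ix i < k}" for k
  have inj: "inj ix" and ran: "range ix = {..<N}" using ix by (auto simp: bij_betw_def)
  have bij: "bij_betw ix (I k) {..<k}" if "k \<le> N" for k
    using that ran inj unfolding I_def bij_betw_def
    by (auto simp: inj_on_def image_iff)
  \<comment> \<open>The empty filter has no code. The bound \<open>a k \<ge> 2\<close> means that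
    index 0 is never removed: it belongs to every nonempty filter.\<close>
  define encode where "encode F k b \<longleftrightarrow> 1 \<le> k \<and> k \<le> N \<and> (b \<longrightarrow> a k \<ge> 2) \<and>
      F = (if b then I k - {i. ix i = a k - 1} else I k)" for F k b
  have enc: "F = {} \<or> (\<exists>k b. encode F k b)" if v: "indicator_vec F \<in> ?V" for F
  proof (cases "F = {}")
    case False
    obtain G where "indicator_vec F = indicator_vec G" and G: "\<And>i j. i \<in> G \<Longrightarrow> lt i j \<Longrightarrow> j \<in> G"
      using order_polytope_vertex[OF v] by metis
    then have "F = G" by (metis support_indicator_vec)
    have "Max (ix ` F) \<in> ix ` F" using False by (intro Max_in) auto
    then obtain m where m: "m \<in> F" "ix m = Max (ix ` F)" by auto
    define k where "k = Suc (ix m)"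
    have "k \<le> N" using ran by (auto simp: k_def Suc_le_eq)
    have sub: "F \<subseteq> I k" using m(2) by (auto simp: I_def k_def less_Suc_eq_le)
    have sup: "j \<in> F" if "j \<in> I k" "\<not> (a k \<ge> 2 \<and> ix j = a k - 1)" for j
    proof (cases "j = m")
      case False
      then have "ix j < ix m" using that(1) injD[OF inj, of j m] by (auto simp: I_def k_def less_Suc_eq)
      then show ?thesis using G lt[of j m] that(2) m(1) \<open>F = G\<close> by (auto simp: k_def)
    qed (use m in simp)
    show ?thesis
    proof (cases "F = I k")
      case True
      then have "encode F k False" using \<open>k \<le> N\<close> by (simp add: encode_def k_def)
      then show ?thesis by blast
    next
      case False
      then obtain j where j: "j \<in> I k" "j \<notin> F" "a k \<ge> 2" "ix j = a k - 1" using sub sup by blast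
      have single: "{i. ix i = a k - 1} = {j}"
        unfolding j(4)[symmetric] using inj by (auto dest: injD)
      have "F = I k - {j}"
      proof
        show "F \<subseteq> I k - {j}" using sub j(2) by blast
        show "I k - {j} \<subseteq> F" using sup single by blast
      qed
      then have "F = I k - {i. ix i = a k - 1}" by (simp only: single)
      then have "encode F k True" using \<open>k \<le> N\<close> j(3) by (simp add: encode_def k_def)
      then show ?thesis by blast
    qed
  qed simp
  have val: "s 0 + y \<bullet> indicator_vec F = filter_value a s k b"
    if s: "\<And>k. k \<le> N \<Longrightarrow> s k = s 0 + (\<Sum>i\<in>I k. y $ i)" and F: "encode F k b" for s y F k b
  proof (cases b)
    case True
    have ak: "a k < k" "a k \<ge> 2" "k \<le> N"
      using turn_index(1)[OF a1 step, of k] F True by (auto simp: encode_def)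
    \<comment> \<open>Writing the removed element as a difference of two initial segments expresses
      its coordinate through values of \<open>s\<close>.\<close>
    have "I k - {i. ix i = a k - 1} = I k - (I (a k) - I (a k - 1))"
      using ak by (auto simp: I_def)
    moreover have "I (a k - 1) \<subseteq> I (a k)" "I (a k) - I (a k - 1) \<subseteq> I k" using ak by (auto simp: I_def)
    ultimately have "(\<Sum>i\<in>F. y $ i) = (\<Sum>i\<in>I k. y $ i) - ((\<Sum>i\<in>I (a k). y $ i) - (\<Sum>i\<in>I (a k - 1). y $ i))"
      using F True by (simp add: encode_def sum_diff)
    then show ?thesis
      using True ak s[of k] s[of "a k"] s[of "a k - 1"] by (simp add: inner_indicator_vec filter_value_def)
  next
    case False
    then show ?thesis
      using F s[of k] by (simp add: inner_indicator_vec filter_value_def encode_def)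
  qed
  have lift: "\<exists>y'. (\<forall>i. y' $ i \<in> \<int>) \<and> (\<forall>F k b. encode F k b \<longrightarrow> s 0 + y' \<bullet> indicator_vec F = filter_value a s k b)"
    if s: "\<And>k. s k \<in> \<int>" for s
  proof -
    \<comment> \<open>The gradient consists of consecutive differences, so integral values on
      initial segments give an integral gradient.\<close>
    define y' :: "real ^ 'n" where "y' = (\<chi> i. s (Suc (ix i)) - s (ix i))"
    have "s k = s 0 + (\<Sum>i\<in>I k. y' $ i)" if "k \<le> N" for k
      using sum.reindex_bij_betw[OF bij[OF that], of "\<lambda>j. s (Suc j) - s j"]
      by (simp add: y'_def sum_lessThan_telescope)
    then have "s 0 + y' \<bullet> indicator_vec F = filter_value a s k b" if "encode F k b" for F k b
      using val that by blast
    moreover have "y' $ i \<in> \<int>" for i using s by (simp add: y'_def Ints_diff)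
    ultimately show ?thesis by blast
  qed
  show ?thesis
  proof (rule unimodular_triangulation[OF T])
    show V01: "?V \<subseteq> range indicator_vec" using order_polytope_vertex by blast
    fix c y v assume v: "v \<in> ?V" "c + y \<bullet> v = 1"
    define s where "s k = c + (\<Sum>i\<in>I k. y $ i)" for k
    have "s 0 = c" by (simp add: s_def I_def)
    then have sval: "c + y \<bullet> indicator_vec F = filter_value a s k b" if "encode F k b" for F k b
      using val[of s y F k b] that by (simp add: s_def)
    obtain F0 where F0: "v = indicator_vec F0" using V01 v(1) by blast
    have "\<exists>s'. (\<forall>k. s' k \<in> \<int>) \<and> (if F0 = {} then s' 0 = 1 else s' 0 = 0 \<and> (\<forall>k b. encode F0 k b \<longrightarrow> filter_value a s' k b = 1)) \<and>
      (\<forall>F k b. encode F k b \<longrightarrow> filter_value a s k b = 0 \<longrightarrow> filter_value a s' k b = 0)"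
    proof (cases "F0 = {}")
      case True
      \<comment> \<open>At the empty filter the function that is 1 there and 0 at all other vertices
        works, since codes involve only positive indices of \<open>s'\<close>.\<close>
      then show ?thesis
        by (intro exI[of _ "\<lambda>k. if k = 0 then 1 else 0"]) (auto simp: filter_value_def encode_def)
    next
      case False
      obtain k0 b0 where k0: "encode F0 k0 b0" using enc v(1) F0 False by blast
      obtain s' where s': "s' 0 = 0" "\<And>k. s' k \<in> \<int>" "filter_value a s' k0 b0 = 1"
        "\<And>k b. k \<ge> 1 \<Longrightarrow> (b \<Longrightarrow> a k \<ge> 2) \<Longrightarrow> filter_value a s k b = 0 \<Longrightarrow> filter_value a s' k b = 0"
        using integral_filter_value[OF a1 step, of k0 b0 s] k0 sval[OF k0] v(2) F0 by (auto simp: encode_def)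
      obtain y' where "\<And>F k b. encode F k b \<Longrightarrow> s' 0 + y' \<bullet> indicator_vec F = filter_value a s' k b"
        using lift[of s'] s'(2) by blast
      then have "filter_value a s' k b = 1" if "encode F0 k b" for k b
        using s'(3) k0 that by metis
      then show ?thesis
        using s' False by (intro exI[of _ s']) (auto simp: encode_def)
    qed
    then obtain s' where s'_int: "\<forall>k. s' k \<in> \<int>"
      and s'_F0: "if F0 = {} then s' 0 = 1 else s' 0 = 0 \<and> (\<forall>k b. encode F0 k b \<longrightarrow> filter_value a s' k b = 1)"
      and s'_zero: "\<forall>F k b. encode F k b \<longrightarrow> filter_value a s k b = 0 \<longrightarrow> filter_value a s' k b = 0"
      by blast
    have s': "\<And>k. s' k \<in> \<int>" "F0 = {} \<Longrightarrow> s' 0 = 1" "F0 \<noteq> {} \<Longrightarrow> s' 0 = 0"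
      "\<And>k b. F0 \<noteq> {} \<Longrightarrow> encode F0 k b \<Longrightarrow> filter_value a s' k b = 1"
      "\<And>F k b. encode F k b \<Longrightarrow> filter_value a s k b = 0 \<Longrightarrow> filter_value a s' k b = 0"
      using s'_int s'_F0 s'_zero by simp_all
    obtain y' where y': "\<And>i. y' $ i \<in> \<int>"
      "\<And>F k b. encode F k b \<Longrightarrow> s' 0 + y' \<bullet> indicator_vec F = filter_value a s' k b"
      using lift[of s'] s'(1) by blast
    have "s' 0 + y' \<bullet> v = 1"
    proof (cases "F0 = {}")
      case False
      then obtain k b where "encode F0 k b" using enc v(1) F0 by blast
      then show ?thesis using y'(2) s'(4) False F0 by metis
    qed (use s'(2) F0 in \<open>simp add: inner_indicator_vec\<close>)
    moreover have "s' 0 + y' \<bullet> u = 0" if u: "u \<in> ?V" "c + y \<bullet> u = 0" for u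
    proof -
      obtain F where F: "u = indicator_vec F" using V01 u(1) by blast
      show ?thesis
      proof (cases "F = {}")
        case True
        then have "c = 0" using u(2) F by (simp add: inner_indicator_vec)
        then have "F0 \<noteq> {}" using v(2) F0 by (auto simp: inner_indicator_vec)
        then show ?thesis using s'(3) True F by (simp add: inner_indicator_vec)
      next
        case False
        then obtain k b where "encode F k b" using enc u(1) F by blast
        then show ?thesis using y'(2) s'(5) sval u(2) F by metis
      qed
    qed
    ultimately show "\<exists>c' y'. (\<forall>i. y' $ i \<in> \<int>) \<and> c' + y' \<bullet> v = 1 \<and> (\<forall>u\<in>?V. c + y \<bullet> u = 0 \<longrightarrow> c' + y' \<bullet> u = 0)"
      using y'(1) by blast
  qed
qed

subsection \<open>The poset of meet-irreducibles of a snake lattice\<close>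

text \<open>turn w k says that 2k+2 is covered by 2k-1 rather than by 2k.\<close>

definition turn :: "letter list \<Rightarrow> nat \<Rightarrow> bool" where
  "turn w k \<longleftrightarrow> k = 1 \<and> snake_letter w k = L \<or> k \<ge> 2 \<and> snake_letter w (k - 1) \<noteq> snake_letter w k"

text \<open>For two consecutive letters, and likewise for the first one, exactly one of the two
  conditional covers occurs, so one test \<open>turn\<close> decides.\<close>

lemma snake_covers_Suc:
  assumes "n = Suc m"
  shows "snake_covers w n = snake_covers w m \<union>
    {(2*n+3, 2*n+1), (2*n+3, 2*n+2), (2*n+2, if turn w n then 2*n-1 else 2*n)}"
proof -
  have "(n = 1 \<and> snake_letter w n = L \<or> n \<ge> 2 \<and> (snake_letter w (n-1), snake_letter w n) \<in> {(R, L), (L, R)}) \<longleftrightarrow> turn w n"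
    by (cases "snake_letter w (n-1)"; cases "snake_letter w n"; simp add: turn_def)
  moreover have "(n = 1 \<and> snake_letter w n = R \<or> n \<ge> 2 \<and> (snake_letter w (n-1), snake_letter w n) \<in> {(L, L), (R, R)}) \<longleftrightarrow> \<not> turn w n"
    using assms by (cases "snake_letter w (n-1)"; cases "snake_letter w n"; auto simp: turn_def)
  ultimately show ?thesis
    unfolding assms by (cases "turn w (Suc m)") (simp_all only: snake_covers.simps Let_def if_True if_False not_False_eq_True not_True_eq_False Un_empty_right Un_insert_right Un_assoc insert_commute simp_thms)
qed

text \<open>up w x is the set of all elements above x; these are smaller as numbers.\<close>

primrec up_even :: "letter list \<Rightarrow> nat \<Rightarrow> nat set" where
  "up_even w 0 = {}"
| "up_even w (Suc k) = (if turn w k then {..<2*k} else insert (2*k) (up_even w k))"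

text \<open>The element \<open>2*m+3\<close> is the minimum of the poset built after
  \<open>m\<close> letters, so an odd element lies below all smaller numbers; only even ones need
  the recursion.\<close>

definition up :: "letter list \<Rightarrow> nat \<Rightarrow> nat set" where
  "up w x = (if odd x then {..<x} else up_even w (x div 2))"

lemma up_odd [simp]: "up w (Suc (2*m)) = {..<Suc (2*m)}" and up_double [simp]: "up w (2*k) = up_even w k"
  by (auto simp: up_def)

lemma up_even_Suc: "up w (2*k+2) = (if turn w k then {..<2*k} else insert (2*k) (up_even w k))"
  using up_double[of w "Suc k"] by simp

lemma up_odd_3: "up w (2*m+3) = {..<2*m+3}"
  by (simp add: up_def)

lemma up_1: "up w 1 = {0}"
  by (auto simp: up_def)

lemma turn_0 [simp]: "\<not> turn w 0"
  by (simp add: turn_def)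

lemma up_2: "up w 2 = {0}"
  using up_even_Suc[of w 0] by (simp add: numeral_2_eq_2)

text \<open>The bound also excludes \<open>2*k-1\<close>, so for positive \<open>k\<close> the
  elements \<open>2*k-1\<close> and \<open>2*k\<close> are incomparable. This gives
  \<open>2*k+1\<close> two covers.\<close>

lemma up_even_bound: "up_even w k \<subseteq> {..<2*k-1}"
  by (induction k) auto

lemma up_less: "y \<in> up w x \<Longrightarrow> y < x"
  using up_even_bound[of w "x div 2"] by (auto simp: up_def split: if_splits)

lemma up_trans: "y \<in> up w x \<Longrightarrow> u \<in> up w y \<Longrightarrow> u \<in> up w x"
proof (cases "odd x")
  case True
  then show "y \<in> up w x \<Longrightarrow> u \<in> up w y \<Longrightarrow> u \<in> up w x"
    using up_less[of u w y] by (auto simp: up_def)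
next
  case False
  then obtain k where "x = 2 * k" by blast
  moreover have "y \<in> up_even w k \<Longrightarrow> u \<in> up w y \<Longrightarrow> u \<in> up_even w k"
    using up_less[of u w y] by (induction k) (auto split: if_splits)
  ultimately show "y \<in> up w x \<Longrightarrow> u \<in> up w y \<Longrightarrow> u \<in> up w x" by simp
qed

lemma zero_in_up: "x > 0 \<Longrightarrow> 0 \<in> up w x"
proof (cases "odd x")
  case False
  then obtain k where k: "x = 2 * k" by blast
  have "k > 0 \<Longrightarrow> 0 \<in> up_even w k"
  proof (induction k)
    case (Suc k)
    then show ?case by (cases k) (auto simp: turn_def)
  qed simp
  then show "x > 0 \<Longrightarrow> 0 \<in> up w x" using k by simp
qed (auto simp: up_def)

lemma snake_covers_up:
  "(x, y) \<in> snake_covers w n \<Longrightarrow> x \<le> 2*n+3 \<and> y \<in> up w x"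
proof (induction n)
  case 0
  then consider "(x, y) = (1, 0)" | "(x, y) = (2, 0)" | "(x, y) = (3, 1)" | "(x, y) = (3, 2)"
    unfolding snake_covers.simps by blast
  then show ?case
    using up_1[of w] up_2[of w] up_odd_3[of w 0] by cases simp_all
next
  case (Suc m)
  define n where "n = Suc m"
  have "(x, y) \<in> snake_covers w n"
    using Suc.prems by (simp only: n_def)
  then consider "(x, y) \<in> snake_covers w m" | "x = 2*n+3" "y = 2*n+1" | "x = 2*n+3" "y = 2*n+2"
    | "x = 2*n+2" "y = (if turn w n then 2*n-1 else 2*n)"
    unfolding snake_covers_Suc[OF n_def] by blast
  then have "x \<le> 2*n+3 \<and> y \<in> up w x"
  proof cases
    case 1
    then show ?thesis using Suc.IH by (simp add: n_def)
  next
    case 4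
    then show ?thesis unfolding 4 up_even_Suc by (simp add: n_def)
  qed (simp_all only: up_odd_3 lessThan_iff, simp_all)
  then show ?case by (simp only: n_def)
qed

lemma snake_covers_mono: "m \<le> n \<Longrightarrow> snake_covers w m \<subseteq> snake_covers w n"
  by (induction n rule: dec_induct) (use snake_covers_Suc in fast)+

lemma snake_covers_odd:
  assumes "m \<le> n"
  shows "(2*m+3, 2*m+1) \<in> snake_covers w n" "(2*m+3, 2*m+2) \<in> snake_covers w n"
proof -
  have "(2*m+3, 2*m+1) \<in> snake_covers w m \<and> (2*m+3, 2*m+2) \<in> snake_covers w m"
  proof (cases m)
    case (Suc k)
    then show ?thesis using snake_covers_Suc[OF Suc] by blast
  qed (simp add: eval_nat_numeral)
  then show "(2*m+3, 2*m+1) \<in> snake_covers w n" "(2*m+3, 2*m+2) \<in> snake_covers w n"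
    using snake_covers_mono[OF assms] by blast+
qed

lemma snake_covers_even:
  assumes "k \<le> n"
  shows "(2*k+2, if turn w k then 2*k-1 else 2*k) \<in> snake_covers w n"
proof -
  have "(2*k+2, if turn w k then 2*k-1 else 2*k) \<in> snake_covers w k"
  proof (cases k)
    case (Suc m)
    then show ?thesis using snake_covers_Suc[OF Suc] by blast
  qed simp
  then show ?thesis using snake_covers_mono[OF assms] by blast
qed

text \<open>Every element of \<open>up w x\<close> is a cover of \<open>x\<close> or lies above one,
  and covers are smaller numbers, so strong induction applies.\<close>

lemma up_snake_covers_trancl:
  "x \<le> 2*n+3 \<Longrightarrow> y \<in> up w x \<Longrightarrow> (x, y) \<in> (snake_covers w n)\<^sup>+"
proof (induction x rule: less_induct)
  case (less x)
  have via: "(x, y) \<in> (snake_covers w n)\<^sup>+" if "(x, z) \<in> snake_covers w n" "y = z \<or> y \<in> up w z" for z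
  proof (cases "y = z")
    case False
    moreover have "z < x" "z \<le> 2*n+3"
      using snake_covers_up[OF that(1)] up_less[of z w x] by auto
    ultimately show ?thesis
      using that less.IH[of z] by (auto intro: trancl_into_trancl2)
  qed (use that(1) in auto)
  consider "x = 0" | "x = 1" | m where "x = 2*m+3" | k where "x = 2*k+2"
  proof -
    have "x = 0 \<or> x = 1 \<or> (\<exists>m. x = 2*m+3) \<or> (\<exists>k. x = 2*k+2)" by presburger
    then show ?thesis using that by blast
  qed
  then show ?case
  proof cases
    case 1
    then show ?thesis using less.prems(2) up_less by blast
  next
    case 2
    moreover have "(1, 0) \<in> snake_covers w n" using snake_covers_mono[of 0 n w] by auto
    ultimately show ?thesis using via less.prems(2) up_less[of y w x] by auto
  next
    case (3 m)
    then have "m \<le> n" "y < 2*m+3" using less.prems up_less by auto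
    moreover have "y < 2*m+1 \<Longrightarrow> y \<in> up w (2*m+1)" by simp
    ultimately show ?thesis
      using via[of "2*m+1"] via[of "2*m+2"] snake_covers_odd[of m n w] 3 by fastforce
  next
    case (4 k)
    then have "k \<le> n" and y: "y \<in> up_even w (Suc k)"
      using less.prems up_double[of w "Suc k"] by auto
    note cov = snake_covers_even[OF \<open>k \<le> n\<close>, of w]
    show ?thesis
    proof (cases "turn w k")
      case True
      then obtain m where m: "k = Suc m" by (cases k) auto
      have "y = 2*k-1 \<or> y \<in> up w (2*k-1)" using y True m by auto
      then show ?thesis using via[of "2*k-1"] cov True 4 by simp
    next
      case False
      then show ?thesis using via[of "2*k"] cov y 4 by simp
    qed
  qed
qed

lemma snake_less_eq: "snake_less w = {(x, y). x \<le> 2 * length w + 3 \<and> y \<in> up w x}"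
proof -
  have "x \<le> 2 * length w + 3 \<and> y \<in> up w x" if "(x, y) \<in> (snake_covers w (length w))\<^sup>+" for x y
    using that by (induction rule: trancl_induct) (use snake_covers_up up_trans in blast)+
  then show ?thesis
    unfolding snake_less_def using up_snake_covers_trancl by blast
qed

section \<open>Covers and meet-irreducibles of the lattice\<close>

lemma snake_hat_less_iff:
  "(u, v) \<in> snake_hat_less w \<longleftrightarrow>
    (case u of Bot \<Rightarrow> (case v of Bot \<Rightarrow> False | Elt y \<Rightarrow> y \<le> 2 * length w + 3 | Top \<Rightarrow> True)
     | Elt x \<Rightarrow> x \<le> 2 * length w + 3 \<and> (case v of Bot \<Rightarrow> False | Elt y \<Rightarrow> y \<in> up w x | Top \<Rightarrow> True)
     | Top \<Rightarrow> False)"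
  by (auto simp: snake_hat_less_def hat_less_def snake_carrier_def snake_less_eq split: hat.splits)

lemma covered_by_Elt:
  assumes "x \<le> 2 * length w + 3"
  shows "covered_by (snake_hat_less w) (Elt x) v \<longleftrightarrow>
    (x = 0 \<and> v = Top) \<or> (\<exists>y. v = Elt y \<and> y \<in> up w x \<and> (\<forall>u\<in>up w x. y \<notin> up w u))"
proof (cases v)
  case Top
  show ?thesis
  proof (cases "x = 0")
    case True
    then have "up w x = {}" using up_less by blast
    then show ?thesis
      using Top True by (auto simp: covered_by_def snake_hat_less_iff split: hat.splits)
  next
    case False
    then have "(Elt x, Elt 0) \<in> snake_hat_less w \<and> (Elt 0, Top) \<in> snake_hat_less w"
      using zero_in_up assms by (auto simp: snake_hat_less_iff)
    then show ?thesis using Top False by (auto simp: covered_by_def)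
  qed
next
  case (Elt y)
  have "u \<le> 2 * length w + 3" if "u \<in> up w x" for u
    using up_less[OF that] assms by simp
  then show ?thesis
    using Elt assms by (auto simp: covered_by_def snake_hat_less_iff split: hat.splits)
qed (auto simp: covered_by_def snake_hat_less_iff)

lemma covered_by_Elt_unique:
  assumes x: "x \<le> 2 * length w + 3" and up: "up w x = insert p (up w p)"
  shows "\<exists>!v. covered_by (snake_hat_less w) (Elt x) v"
proof -
  have "p < x" using up up_less[of p w x] by simp
  moreover have "y \<in> up w x \<and> (\<forall>u\<in>up w x. y \<notin> up w u) \<longleftrightarrow> y = p" for y
  proof -
    have "p \<notin> up w u" if "u \<in> up w p" for u
      using up_less[OF that] up_less[of p w u] by auto
    moreover have "p \<notin> up w p" using up_less by blast
    ultimately show ?thesis unfolding up by blast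
  qed
  ultimately show ?thesis
    by (intro ex1I[of _ "Elt p"]) (auto simp: covered_by_Elt[OF x])
qed

lemma covered_by_Bot_unique: "\<exists>!v. covered_by (snake_hat_less w) Bot v"
proof (rule ex1I[of _ "Elt (2 * length w + 3)"])
  let ?t = "2 * length w + 3"
  show "covered_by (snake_hat_less w) Bot (Elt ?t)"
    using up_less[of ?t w] by (force simp: covered_by_def snake_hat_less_iff split: hat.splits)
  fix v assume v: "covered_by (snake_hat_less w) Bot v"
  have up_t: "up w ?t = {..<?t}" by (simp add: up_def)
  have "(Bot, Elt ?t) \<in> snake_hat_less w" by (simp add: snake_hat_less_iff)
  then have "(Elt ?t, v) \<notin> snake_hat_less w" using v by (auto simp: covered_by_def)
  moreover have "(Bot, v) \<in> snake_hat_less w" using v by (simp add: covered_by_def)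
  ultimately show "v = Elt ?t"
    using up_t by (cases v) (auto simp: snake_hat_less_iff)
qed

text \<open>For 1 and the even positive elements, everything above the element is one cover
  \<open>p\<close> or lies above \<open>p\<close>; 0 is covered by \<open>Top\<close> and
  \<open>Bot\<close> by the last element. The odd elements \<open>2*m+3\<close> have the two covers
  \<open>2*m+1\<close> and \<open>2*m+2\<close>.\<close>

lemma snake_Q_eq: "snake_Q w = {Bot, Elt 0, Elt 1} \<union> (\<lambda>k. Elt (2*k+2)) ` {..length w}"
proof -
  have carrier: "snake_hat w = {Bot, Top} \<union> Elt ` {..2 * length w + 3}"
    by (auto simp: snake_hat_def hat_carrier_def snake_carrier_def)
  have zero: "\<exists>!v. covered_by (snake_hat_less w) (Elt 0) v"
    using up_less[of _ w 0] by (intro ex1I[of _ Top]) (auto simp: covered_by_Elt)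
  have one: "\<exists>!v. covered_by (snake_hat_less w) (Elt 1) v"
    using up_1 up_double[of w 0] by (intro covered_by_Elt_unique[where p = 0]) simp_all
  have even: "\<exists>!v. covered_by (snake_hat_less w) (Elt (2*k+2)) v" if "k \<le> length w" for k
  proof (cases "turn w k")
    case True
    then obtain m where m: "k = Suc m" by (cases k) auto
    have "{..<2*k} = insert (2*k-1) {..<2*k-1}" "up w (2*k-1) = {..<2*k-1}" using m by auto
    then have "up w (2*k+2) = insert (2*k-1) (up w (2*k-1))"
      using True by (simp only: up_even_Suc if_True)
    then show ?thesis by (rule covered_by_Elt_unique[rotated]) (use that in simp)
  next
    case False
    then have "up w (2*k+2) = insert (2*k) (up w (2*k))"
      by (simp only: up_even_Suc if_False up_double)
    then show ?thesis by (rule covered_by_Elt_unique[rotated]) (use that in simp)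
  qed
  have odd: "\<not> (\<exists>!v. covered_by (snake_hat_less w) (Elt (2*m+3)) v)" if "m \<le> length w" for m
  proof -
    have up_m: "up w (2*m+3) = {..<2*m+3}" by (simp add: up_def)
    have "2*m+1 \<notin> up w u" if u: "u < 2*m+3" for u
    proof (cases "u = 2*m+2")
      case True
      then show ?thesis using up_even_bound[of w "Suc m"] up_double[of w "Suc m"] by auto
    qed (use u up_less[of "2*m+1" w u] in auto)
    moreover have "2*m+2 \<notin> up w u" if u: "u < 2*m+3" for u
      using u up_less[of "2*m+2" w u] by auto
    ultimately have "covered_by (snake_hat_less w) (Elt (2*m+3)) (Elt (2*m+1))"
      "covered_by (snake_hat_less w) (Elt (2*m+3)) (Elt (2*m+2))"
      using that by (auto simp: covered_by_Elt up_m)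
    moreover have "Elt (2*m+1) \<noteq> Elt (2*m+2)" by simp
    ultimately show ?thesis by blast
  qed
  show ?thesis
  proof (intro set_eqI iffI)
    fix v assume v: "v \<in> snake_Q w"
    then have v': "v \<in> snake_hat w" "v \<noteq> Top" "\<exists>!y. covered_by (snake_hat_less w) v y"
      by (auto simp: snake_Q_def)
    show "v \<in> {Bot, Elt 0, Elt 1} \<union> (\<lambda>k. Elt (2*k+2)) ` {..length w}"
    proof (cases v)
      case (Elt x)
      have x: "x \<le> 2 * length w + 3" using v'(1) Elt carrier by auto
      have "x = 0 \<or> x = 1 \<or> (\<exists>m. x = 2*m+3) \<or> (\<exists>k. x = 2*k+2)" by presburger
      then consider "x = 0" | "x = 1" | m where "x = 2*m+3" | k where "x = 2*k+2" by blast
      then show ?thesis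
      proof cases
        case (3 m)
        then show ?thesis using odd[of m] v'(3) Elt x by simp
      next
        case (4 k)
        then show ?thesis using Elt x by simp
      qed (use Elt in simp_all)
    qed (use v'(2) in auto)
  next
    fix v assume v: "v \<in> {Bot, Elt 0, Elt 1} \<union> (\<lambda>k. Elt (2*k+2)) ` {..length w}"
    then have "v \<in> snake_hat w" "v \<noteq> Top" unfolding carrier by auto
    moreover have "\<exists>!y. covered_by (snake_hat_less w) v y"
      using v zero one even covered_by_Bot_unique by blast
    ultimately show "v \<in> snake_Q w" unfolding snake_Q_def by blast
  qed
qed

section \<open>A linear order on the meet-irreducibles\<close>

definition position :: "letter list \<Rightarrow> nat hat \<Rightarrow> nat" where
  "position w v = (case v of Bot \<Rightarrow> length w + 3 | Elt x \<Rightarrow> (if x \<le> 1 then x else x div 2 + 1) | Top \<Rightarrow> 0)"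

text \<open>The list is 0, 1, 2, 4, 6, ... followed by \<open>Bot\<close>, so \<open>2*k+2\<close>
  has position \<open>k + 2\<close>. The value at \<open>Top\<close> is a default outside
  \<open>snake_Q w\<close>.\<close>

lemma bij_position: "bij_betw (position w) (snake_Q w) {..<length w + 4}"
proof (rule bij_betw_byWitness[where f' =
    "\<lambda>j. if j = length w + 3 then Bot else if j \<le> 1 then Elt j else Elt (2 * (j - 1))"])
  show "position w ` snake_Q w \<subseteq> {..<length w + 4}"
    by (auto simp: snake_Q_eq position_def)
  show "(\<lambda>j. if j = length w + 3 then Bot else if j \<le> 1 then Elt j else Elt (2 * (j - 1))) ` {..<length w + 4} \<subseteq> snake_Q w"
  proof (rule image_subsetI)
    fix j assume j: "j \<in> {..<length w + 4}"
    consider "j = length w + 3" | "j \<le> 1" "j \<noteq> length w + 3" | k where "j = k + 2" "k \<le> length w"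
    proof -
      have "j = length w + 3 \<or> j \<le> 1 \<and> j \<noteq> length w + 3 \<or> j = (j - 2) + 2 \<and> j - 2 \<le> length w"
        using j by auto
      then show ?thesis using that by blast
    qed
    then show "(if j = length w + 3 then Bot else if j \<le> 1 then Elt j else Elt (2 * (j - 1))) \<in> snake_Q w"
      by cases (auto simp: snake_Q_eq)
  qed
qed (auto simp: snake_Q_eq position_def split: if_splits)

text \<open>The element at position k - 1 is incomparable to exactly one element of smaller position,
  the one at position last_turn w k - 1 (for k from 3 to length w + 3).\<close>

primrec last_turn :: "letter list \<Rightarrow> nat \<Rightarrow> nat" where
  "last_turn w 0 = 0"
| "last_turn w (Suc k) = (if k \<le> 2 \<or> turn w (k - 2) then k else last_turn w k)"

text \<open>Induction along \<open>up_even\<close>. At a turn the exception moves to position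
  \<open>k + 2\<close>, the element \<open>2 * Suc k\<close>, and all earlier elements lie above.
  Otherwise the exception stays and \<open>2 * Suc k\<close> is the new cover.\<close>

lemma position_up_even:
  assumes "position w (Elt x) < k + 2" "position w (Elt x) \<noteq> last_turn w (k + 3) - 1" "x \<le> 1 \<or> even x"
  shows "x \<in> up_even w (Suc k)"
  using assms(1,2)
proof (induction k)
  case 0
  then show ?case using assms(3) by (auto simp: position_def eval_nat_numeral split: if_splits)
next
  case (Suc k)
  show ?case
  proof (cases "turn w (Suc k)")
    case True
    then have "position w (Elt x) \<le> Suc k" using Suc.prems by (auto simp: eval_nat_numeral)
    then have "x < 2 * Suc k" using assms(3) by (auto simp: position_def split: if_splits)
    then show ?thesis using True by simp
  next
    case False
    then have lt: "last_turn w (Suc k + 3) = last_turn w (k + 3)" by (simp add: eval_nat_numeral)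
    show ?thesis
    proof (cases "position w (Elt x) = k + 2")
      case True
      then have "x = 2 * Suc k" using assms(3) by (auto simp: position_def split: if_splits)
      then show ?thesis using False by simp
    next
      case neq: False
      then have "x \<in> up_even w (Suc k)" using Suc lt by simp
      then show ?thesis using False by simp
    qed
  qed
qed

lemma last_turn_ge_2: "k \<ge> 3 \<Longrightarrow> last_turn w k \<ge> 2"
  by (induction k rule: dec_induct) (auto simp: eval_nat_numeral)

lemma snake_hat_less_position:
  assumes u: "u \<in> snake_Q w" and v: "v \<in> snake_Q w" and less: "position w v < position w u"
    and neq: "\<not> (last_turn w (Suc (position w u)) \<ge> 2 \<and> position w v = last_turn w (Suc (position w u)) - 1)"
  shows "(u, v) \<in> snake_hat_less w"
proof -
  have "v \<noteq> Bot" using less u by (auto simp: position_def snake_Q_eq)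
  then obtain y where y: "v = Elt y" "y \<le> 1 \<or> even y" "y \<le> 2 * length w + 3"
    using v by (auto simp: snake_Q_eq)
  consider "u = Bot" | "u = Elt 0" | "u = Elt 1" | k where "u = Elt (2*k+2)" "k \<le> length w"
    using u by (auto simp: snake_Q_eq)
  then show ?thesis
  proof cases
    case 1
    \<comment> \<open>\<open>Bot\<close> lies below every other element, whatever exception
      \<open>last_turn\<close> names at its position.\<close>
    then show ?thesis using y by (simp add: snake_hat_less_iff)
  next
    case 2
    then show ?thesis using less by (simp add: position_def)
  next
    case 3
    then have "y = 0" using less y by (auto simp: position_def split: if_splits)
    then show ?thesis using 3 y zero_in_up[of 1 w] by (simp add: snake_hat_less_iff)
  next
    case (4 k)
    then have pos: "position w u = k + 2" by (simp add: position_def)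
    have "last_turn w (k + 3) \<ge> 2" by (rule last_turn_ge_2) simp
    then have "y \<in> up_even w (Suc k)"
      using less neq y pos by (intro position_up_even) (auto simp: eval_nat_numeral)
    then show ?thesis using 4 y up_double[of w "Suc k"] by (simp add: snake_hat_less_iff)
  qed
qed

theorem theorem4p12:
  fixes w :: "letter list" and e :: "'n::finite \<Rightarrow> nat hat"
  assumes "w \<in> words_V"
    and "bij_betw e UNIV (snake_Q w)"
  shows "(\<forall>z. z extreme_point_of secondary_polytope (snake_order_polytope w e) \<longrightarrow>
            (\<exists>T. is_regular_triangulation_of T (snake_order_polytope w e) \<and>
                 gkz_vector T = z \<and> unimodular T)) \<and>
         (\<forall>T. is_triangulation_of T (snake_order_polytope w e) \<longrightarrow> unimodular T)"
proof -
  let ?P = "snake_order_polytope w e"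
  have e: "e i \<in> snake_Q w" for i
    using assms(2) by (auto simp: bij_betw_def)
  have uni: "unimodular T" if "is_triangulation_of T ?P" for T
  \<comment> \<open>The indexing is \<open>position w\<close> after \<open>e\<close>, and
    \<open>last_turn w\<close> serves as the sequence \<open>a\<close>.\<close>
  proof (rule unimodular_order_polytope[where lt = "\<lambda>i j. (e i, e j) \<in> snake_hat_less w"])
    show "bij_betw (position w \<circ> e) UNIV {..<length w + 4}"
      using bij_betw_trans[OF assms(2) bij_position] .
    show "is_triangulation_of T (order_polytope (\<lambda>i j. (e i, e j) \<in> snake_hat_less w))"
      using that by (simp add: snake_order_polytope_def)
    show "last_turn w 1 = 0" by simp
    show "last_turn w (Suc k) = last_turn w k \<or> last_turn w (Suc k) = k" for k by simp
  qed (auto intro!: snake_hat_less_position e simp del: last_turn.simps)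
  have "\<exists>T. is_regular_triangulation_of T ?P \<and> gkz_vector T = z"
    if z: "z extreme_point_of secondary_polytope ?P" for z
  proof -
    have "0 \<in> ?P" by (simp add: snake_order_polytope_def order_polytope_def)
    moreover have "polytope_vertices ?P \<subseteq> range indicator_vec"
      unfolding snake_order_polytope_def using order_polytope_vertex by blast
    moreover have "compact ?P" "convex ?P"
      by (simp_all add: snake_order_polytope_def compact_order_polytope convex_order_polytope)
    ultimately show ?thesis
      using secondary_polytope_vertex_regular[OF _ _ _ _ z] by blast
  qed
  then show ?thesis
    using uni unfolding is_regular_triangulation_of_def by blast
qed

end
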